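(* Let $n\ge 1$. For $2\le k\le n$ let $\psi_{n,k}$ be the bilinear map on $NF^{n,n}$ with $\psi_{n,k}(x_n,y_1)=y_k$, $\psi_{n,k}(x_n,x_1)=2x_k$, $\psi_{n,k}(y_n,x_1)=2y_k$ and value zero on all other pairs of basis elements. Then the cohomology classes $\{\overline{\psi_{n,2}},\overline{\psi_{n,3}},\dots,\overline{\psi_{n,n}}\}$ form a basis of $HL_0^2(NF^{n,n},NF^{n,n})$.
   Context: $F$ is a field of characteristic zero. $NF^{n,n}$ is the Leibniz superalgebra with even basis $x_1,\dots,x_n$, odd basis $y_1,\dots,y_n$ and products $[y_i,y_1]=x_i$ ($1\le i\le n$), $[x_i,y_1]=\frac12y_{i+1}$, $[y_i,x_1]=y_{i+1}$, $[x_i,x_1]=x_{i+1}$ ($1\le i\le n-1$), all other products of basis elements being zero. For a Leibniz superalgebra $L=L_0\oplus L_1$ (a $\mathbb Z_2$-graded algebra with $[x,[y,z]]=[[x,y],z]-(-1)^{|y||z|}[[x,z],y]$), the space $ZL_0^2(L,L)$ of even 2-cocycles consists of the bilinear maps $\varphi:L\times L\to L$ with $\varphi(L_a,L_b)\subseteq L_{a+b}$ such that for all homogeneous $x,y,z\in L$ $$[x,\varphi(y,z)]-[\varphi(x,y),z]+(-1)^{|y||z|}[\varphi(x,z),y]+\varphi(x,[y,z])-\varphi([x,y],z)+(-1)^{|y||z|}\varphi([x,z],y)=0.$$ $BL_0^2(L,L)$ is the space of maps $d^1f$, $f:L\to L$ linear and degree-preserving, where $(d^1f)(x,y)=[x,f(y)]+[f(x),y]-f([x,y])$.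 $HL_0^2(L,L)=ZL_0^2(L,L)/BL_0^2(L,L)$. *)

theory Defs
  imports "HOL-Algebra.AbelCoset" "Jordan_Normal_Form.VS_Connect" "HOL-Library.Z2"
begin

section \<open>Quotients of modules\<close>

text \<open>Built on the additive cosets of HOL-Algebra; scalar multiplication follows the pattern of
  the coset multiplication used there for quotient rings.\<close>

definition quotient_module ::
    "('a, 'm, 'k) module_scheme \<Rightarrow> 'm set \<Rightarrow> ('a, 'm set) module" where
  "quotient_module M N =
    \<lparr>carrier = a_rcosets\<^bsub>M\<^esub> N, mult = undefined, one = undefined, zero = N,
     add = (\<lambda>C D. C <+>\<^bsub>M\<^esub> D),
     smult = (\<lambda>c C. \<Union>u\<in>C. N +>\<^bsub>M\<^esub> (c \<odot>\<^bsub>M\<^esub> u))\<rparr>"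

lemma (in vectorspace) vectorspace_quotient_module:
  assumes N: "subspace K N V"
  shows "vectorspace K (quotient_module V N)"
proof -
  interpret S: submodule K N V
    using N by (simp add: VectorSpace.subspace_def)
  have addN: "additive_subgroup N V"
  proof (intro additive_subgroup.intro subgroup.intro)
    show "inv\<^bsub>add_monoid V\<^esub> h \<in> N" if "h \<in> N" for h
    proof -
      have "(\<ominus>\<^bsub>K\<^esub> \<one>\<^bsub>K\<^esub>) \<odot>\<^bsub>V\<^esub> h \<in> N"
        using that by simp
      moreover have "(\<ominus>\<^bsub>K\<^esub> \<one>\<^bsub>K\<^esub>) \<odot>\<^bsub>V\<^esub> h = \<ominus>\<^bsub>V\<^esub> h"
        using that S.subset by (metis R.one_closed smult_l_minus smult_one subsetD)
      ultimately show ?thesis by (simp add: a_inv_def)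
    qed
  qed (use S.subset in auto)
  interpret N: abelian_subgroup N V
    by (rule abelian_subgroupI3[OF addN]) (rule M.abelian_group_axioms)
  have Nsub: "subgroup N (add_monoid V)"
    by (rule N.a_subgroup)
  have sm: "(\<Union>w\<in>N +>\<^bsub>V\<^esub> u. N +>\<^bsub>V\<^esub> (c \<odot>\<^bsub>V\<^esub> w)) = N +>\<^bsub>V\<^esub> (c \<odot>\<^bsub>V\<^esub> u)"
    if u: "u \<in> carrier V" and c: "c \<in> carrier K" for u c
  proof -
    have "N +>\<^bsub>V\<^esub> (c \<odot>\<^bsub>V\<^esub> w) = N +>\<^bsub>V\<^esub> (c \<odot>\<^bsub>V\<^esub> u)"
      if w: "w \<in> N +>\<^bsub>V\<^esub> u" for w
    proof -
      obtain h where h: "h \<in> N" "w = h \<oplus>\<^bsub>V\<^esub> u"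
        using w by (auto simp: a_r_coset_def')
      have "c \<odot>\<^bsub>V\<^esub> w = c \<odot>\<^bsub>V\<^esub> h \<oplus>\<^bsub>V\<^esub> c \<odot>\<^bsub>V\<^esub> u"
        using h u c S.subset by (auto simp: smult_r_distr subset_iff)
      moreover have "c \<odot>\<^bsub>V\<^esub> h \<in> N"
        using h c by simp
      ultimately have "c \<odot>\<^bsub>V\<^esub> w \<in> N +>\<^bsub>V\<^esub> (c \<odot>\<^bsub>V\<^esub> u)"
        by (auto simp: a_r_coset_def')
      then show ?thesis
        using a_repr_independence[OF _ _ Nsub] u c by simp
    qed
    moreover have "u \<in> N +>\<^bsub>V\<^esub> u"
      using u N.a_rcos_self by simp
    ultimately show ?thesis by blast
  qed
  have car: "carrier (quotient_module V N) = (\<lambda>u. N +>\<^bsub>V\<^esub> u) ` carrier V"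
    by (auto simp: quotient_module_def A_RCOSETS_def')
  have zero: "\<zero>\<^bsub>quotient_module V N\<^esub> = N +>\<^bsub>V\<^esub> \<zero>\<^bsub>V\<^esub>"
    using S.subset by (simp add: quotient_module_def)
  have add: "(N +>\<^bsub>V\<^esub> u) \<oplus>\<^bsub>quotient_module V N\<^esub> (N +>\<^bsub>V\<^esub> v) = N +>\<^bsub>V\<^esub> (u \<oplus>\<^bsub>V\<^esub> v)"
    if "u \<in> carrier V" "v \<in> carrier V" for u v
    using that by (simp add: quotient_module_def N.a_rcos_sum)
  have smult: "c \<odot>\<^bsub>quotient_module V N\<^esub> (N +>\<^bsub>V\<^esub> u) = N +>\<^bsub>V\<^esub> (c \<odot>\<^bsub>V\<^esub> u)"
    if "u \<in> carrier V" "c \<in> carrier K" for u c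
    using sm[OF that] by (simp add: quotient_module_def)
  show ?thesis
  proof (rule vs_criteria)
    show "field K" by (rule field_axioms)
    show "\<forall>v\<in>carrier (quotient_module V N). \<exists>neg_v\<in>carrier (quotient_module V N).
        v \<oplus>\<^bsub>quotient_module V N\<^esub> neg_v = \<zero>\<^bsub>quotient_module V N\<^esub>"
    proof
      fix v assume "v \<in> carrier (quotient_module V N)"
      then obtain u where u: "u \<in> carrier V" "v = N +>\<^bsub>V\<^esub> u"
        by (auto simp: car)
      then show "\<exists>neg_v\<in>carrier (quotient_module V N).
          v \<oplus>\<^bsub>quotient_module V N\<^esub> neg_v = \<zero>\<^bsub>quotient_module V N\<^esub>"
        by (intro bexI[of _ "N +>\<^bsub>V\<^esub> (\<ominus>\<^bsub>V\<^esub> u)"]) (auto simp: add zero car M.r_neg)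
    qed
  qed (auto simp: car zero add smult M.a_ac smult_l_distr smult_r_distr smult_assoc1)
qed

section \<open>Leibniz superalgebras\<close>

definition bilinear_over ::
    "('a::field \<Rightarrow> 'v::ab_group_add \<Rightarrow> 'v) \<Rightarrow> ('v \<Rightarrow> 'v \<Rightarrow> 'v) \<Rightarrow> bool" where
  "bilinear_over scale \<phi> \<longleftrightarrow>
    (\<forall>u. Vector_Spaces.linear scale scale (\<phi> u)) \<and>
    (\<forall>v. Vector_Spaces.linear scale scale (\<lambda>u. \<phi> u v))"

lemma bilinear_over_left:
  assumes "bilinear_over scale \<phi>"
  shows "\<phi> (u + v) w = \<phi> u w + \<phi> v w" "\<phi> (u - v) w = \<phi> u w - \<phi> v w"
    "\<phi> (- u) w = - \<phi> u w" "\<phi> 0 w = 0" "\<phi> (scale c u) w = scale c (\<phi> u w)"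
proof -
  interpret Vector_Spaces.linear scale scale "\<lambda>u. \<phi> u w"
    using assms by (auto simp: bilinear_over_def)
  show "\<phi> (u + v) w = \<phi> u w + \<phi> v w" "\<phi> (u - v) w = \<phi> u w - \<phi> v w"
    "\<phi> (- u) w = - \<phi> u w" "\<phi> 0 w = 0" "\<phi> (scale c u) w = scale c (\<phi> u w)"
    by (simp_all add: add diff neg scale)
qed

lemma bilinear_over_right:
  assumes "bilinear_over scale \<phi>"
  shows "\<phi> w (u + v) = \<phi> w u + \<phi> w v" "\<phi> w (u - v) = \<phi> w u - \<phi> w v"
    "\<phi> w (- u) = - \<phi> w u" "\<phi> w 0 = 0" "\<phi> w (scale c u) = scale c (\<phi> w u)"
proof -
  interpret Vector_Spaces.linear scale scale "\<phi> w"
    using assms by (auto simp: bilinear_over_def)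
  show "\<phi> w (u + v) = \<phi> w u + \<phi> w v" "\<phi> w (u - v) = \<phi> w u - \<phi> w v"
    "\<phi> w (- u) = - \<phi> w u" "\<phi> w 0 = 0" "\<phi> w (scale c u) = scale c (\<phi> w u)"
    by (simp_all add: add diff neg scale)
qed

lemma (in vector_space) linear_overI:
  assumes "\<And>u v. f (u + v) = f u + f v" "\<And>c u. f (scale c u) = scale c (f u)"
  shows "Vector_Spaces.linear scale scale f"
  using assms by unfold_locales (auto simp: algebra_simps)

lemma (in vector_space) bilinear_overI:
  assumes "\<And>u v w. \<phi> (u + v) w = \<phi> u w + \<phi> v w" "\<And>c u w. \<phi> (scale c u) w = scale c (\<phi> u w)"
    and "\<And>u v w. \<phi> w (u + v) = \<phi> w u + \<phi> w v" "\<And>c u w. \<phi> w (scale c u) = scale c (\<phi> w u)"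
  shows "bilinear_over scale \<phi>"
  unfolding bilinear_over_def using assms by (auto intro!: linear_overI)

text \<open>A grading is a function \<open>V\<close> on the two-element type \<open>bit\<close>, in which \<open>1 + 1 = 0\<close>;
  \<open>V 0\<close> is the even and \<open>V 1\<close> the odd part.\<close>

definition even_bilinear ::
    "('a::field \<Rightarrow> 'v::ab_group_add \<Rightarrow> 'v) \<Rightarrow> (bit \<Rightarrow> 'v set) \<Rightarrow> ('v \<Rightarrow> 'v \<Rightarrow> 'v) \<Rightarrow> bool" where
  "even_bilinear scale V \<phi> \<longleftrightarrow>
    bilinear_over scale \<phi> \<and> (\<forall>a b. \<forall>u\<in>V a. \<forall>v\<in>V b. \<phi> u v \<in> V (a + b))"

definition even_linear ::
    "('a::field \<Rightarrow> 'v::ab_group_add \<Rightarrow> 'v) \<Rightarrow> (bit \<Rightarrow> 'v set) \<Rightarrow> ('v \<Rightarrow> 'v) \<Rightarrow> bool" where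
  "even_linear scale V f \<longleftrightarrow>
    Vector_Spaces.linear scale scale f \<and> (\<forall>a. \<forall>u\<in>V a. f u \<in> V a)"

text \<open>The sign \<open>(-1)\<^sup>|\<^sup>v\<^sup>|\<^sup>|\<^sup>w\<^sup>|\<close> applied to a vector.\<close>

definition koszul :: "bit \<Rightarrow> bit \<Rightarrow> 'v::ab_group_add \<Rightarrow> 'v" where
  "koszul b c u = (if b = 1 \<and> c = 1 then - u else u)"

locale leibniz_superalgebra = vector_space scale
  for scale :: "'a::field \<Rightarrow> 'v::ab_group_add \<Rightarrow> 'v" +
  fixes V :: "bit \<Rightarrow> 'v set" and br :: "'v \<Rightarrow> 'v \<Rightarrow> 'v"
  assumes subspace_V: "subspace (V a)"
    and V_Int: "V 0 \<inter> V 1 = {0}"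
    and V_sum: "\<exists>v\<in>V 0. \<exists>w\<in>V 1. u = v + w"
    and br_even: "even_bilinear scale V br"
    and leibniz: "\<lbrakk>u \<in> V a; v \<in> V b; w \<in> V c\<rbrakk> \<Longrightarrow>
      br u (br v w) = br (br u v) w - koszul b c (br (br u w) v)"

section \<open>Even cohomology in degree two with adjoint coefficients\<close>

definition is_even_cocycle2 ::
    "('a::field \<Rightarrow> 'v::ab_group_add \<Rightarrow> 'v) \<Rightarrow> (bit \<Rightarrow> 'v set) \<Rightarrow> ('v \<Rightarrow> 'v \<Rightarrow> 'v) \<Rightarrow>
     ('v \<Rightarrow> 'v \<Rightarrow> 'v) \<Rightarrow> bool" where
  "is_even_cocycle2 scale V br \<phi> \<longleftrightarrow> even_bilinear scale V \<phi> \<and>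
    (\<forall>a b c. \<forall>u\<in>V a. \<forall>v\<in>V b. \<forall>w\<in>V c.
      br u (\<phi> v w) - br (\<phi> u v) w + koszul b c (br (\<phi> u w) v)
      + \<phi> u (br v w) - \<phi> (br u v) w + koszul b c (\<phi> (br u w) v) = 0)"

definition ZL2_even ::
    "('a::field \<Rightarrow> 'v::ab_group_add \<Rightarrow> 'v) \<Rightarrow> (bit \<Rightarrow> 'v set) \<Rightarrow> ('v \<Rightarrow> 'v \<Rightarrow> 'v) \<Rightarrow>
     ('a, 'v \<Rightarrow> 'v \<Rightarrow> 'v) module" where
  "ZL2_even scale V br =
    \<lparr>carrier = {\<phi>. is_even_cocycle2 scale V br \<phi>}, mult = undefined, one = undefined,
     zero = (\<lambda>u v. 0), add = (\<lambda>\<phi> \<psi> u v. \<phi> u v + \<psi> u v),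
     smult = (\<lambda>c \<phi> u v. scale c (\<phi> u v))\<rparr>"

definition d1 :: "('v \<Rightarrow> 'v \<Rightarrow> 'v) \<Rightarrow> ('v \<Rightarrow> 'v) \<Rightarrow> 'v::ab_group_add \<Rightarrow> 'v \<Rightarrow> 'v" where
  "d1 br f u v = br u (f v) + br (f u) v - f (br u v)"

definition BL2_even ::
    "('a::field \<Rightarrow> 'v::ab_group_add \<Rightarrow> 'v) \<Rightarrow> (bit \<Rightarrow> 'v set) \<Rightarrow> ('v \<Rightarrow> 'v \<Rightarrow> 'v) \<Rightarrow>
     ('v \<Rightarrow> 'v \<Rightarrow> 'v) set" where
  "BL2_even scale V br = {d1 br f | f. even_linear scale V f}"

definition HL2_even ::
    "('a::field \<Rightarrow> 'v::ab_group_add \<Rightarrow> 'v) \<Rightarrow> (bit \<Rightarrow> 'v set) \<Rightarrow> ('v \<Rightarrow> 'v \<Rightarrow> 'v) \<Rightarrow>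
     ('a, ('v \<Rightarrow> 'v \<Rightarrow> 'v) set) module" where
  "HL2_even scale V br = quotient_module (ZL2_even scale V br) (BL2_even scale V br)"

definition cohomology_class ::
    "('a::field \<Rightarrow> 'v::ab_group_add \<Rightarrow> 'v) \<Rightarrow> (bit \<Rightarrow> 'v set) \<Rightarrow> ('v \<Rightarrow> 'v \<Rightarrow> 'v) \<Rightarrow>
     ('v \<Rightarrow> 'v \<Rightarrow> 'v) \<Rightarrow> ('v \<Rightarrow> 'v \<Rightarrow> 'v) set" where
  "cohomology_class scale V br \<phi> = BL2_even scale V br +>\<^bsub>ZL2_even scale V br\<^esub> \<phi>"

context leibniz_superalgebra
begin

lemma koszul_linear:
  "koszul b c (u + v) = koszul b c u + koszul b c v"
  "koszul b c (scale r u) = scale r (koszul b c u)" "koszul b c 0 = 0"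
  for u v :: 'v
  by (auto simp: koszul_def)

lemma V_closed:
  "0 \<in> V a" "u \<in> V a \<Longrightarrow> v \<in> V a \<Longrightarrow> u + v \<in> V a" "u \<in> V a \<Longrightarrow> v \<in> V a \<Longrightarrow> u - v \<in> V a"
  "u \<in> V a \<Longrightarrow> scale c u \<in> V a"
  using subspace_V[of a] by (auto intro: subspace_0 subspace_add subspace_diff subspace_scale)

lemma even_bilinear_add:
  assumes "even_bilinear scale V \<phi>" "even_bilinear scale V \<psi>"
  shows "even_bilinear scale V (\<lambda>u v. \<phi> u v + \<psi> u v)"
proof -
  have b: "bilinear_over scale \<phi>" "bilinear_over scale \<psi>"
    using assms by (auto simp: even_bilinear_def)
  note l = bilinear_over_left[OF b(1)] bilinear_over_left[OF b(2)]
    bilinear_over_right[OF b(1)] bilinear_over_right[OF b(2)]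
  have "bilinear_over scale (\<lambda>u v. \<phi> u v + \<psi> u v)"
    by (rule bilinear_overI) (simp_all add: l algebra_simps scale_right_distrib)
  then show ?thesis
    using assms unfolding even_bilinear_def by (blast intro: V_closed)
qed

lemma even_bilinear_scale:
  assumes "even_bilinear scale V \<phi>"
  shows "even_bilinear scale V (\<lambda>u v. scale c (\<phi> u v))"
proof -
  have b: "bilinear_over scale \<phi>"
    using assms by (auto simp: even_bilinear_def)
  note l = bilinear_over_left[OF b] bilinear_over_right[OF b]
  have "bilinear_over scale (\<lambda>u v. scale c (\<phi> u v))"
    by (rule bilinear_overI) (simp_all add: l scale_right_distrib mult.commute)
  then show ?thesis
    using assms unfolding even_bilinear_def by (blast intro: V_closed)
qed

lemma even_bilinear_0: "even_bilinear scale V (\<lambda>u v. 0)"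
  unfolding even_bilinear_def by (auto intro!: bilinear_overI V_closed)

lemmas br_bil = br_even[unfolded even_bilinear_def, THEN conjunct1]
lemmas br_lin = bilinear_over_left[OF br_bil] bilinear_over_right[OF br_bil]

lemma cocycle2_0: "is_even_cocycle2 scale V br (\<lambda>u v. 0)"
  by (simp add: is_even_cocycle2_def even_bilinear_0 br_lin koszul_linear)

lemma cocycle2_add:
  assumes "is_even_cocycle2 scale V br \<phi>" "is_even_cocycle2 scale V br \<psi>"
  shows "is_even_cocycle2 scale V br (\<lambda>u v. \<phi> u v + \<psi> u v)"
  unfolding is_even_cocycle2_def
proof (intro conjI allI ballI)
  show "even_bilinear scale V (\<lambda>u v. \<phi> u v + \<psi> u v)"
    using assms by (auto simp: is_even_cocycle2_def intro: even_bilinear_add)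
next
  fix a b c u v w
  assume *: "u \<in> V a" "v \<in> V b" "w \<in> V c"
  let ?c = "\<lambda>\<phi>. br u (\<phi> v w) - br (\<phi> u v) w + koszul b c (br (\<phi> u w) v)
      + \<phi> u (br v w) - \<phi> (br u v) w + koszul b c (\<phi> (br u w) v)"
  have "?c (\<lambda>u v. \<phi> u v + \<psi> u v) = ?c \<phi> + ?c \<psi>"
    by (simp add: br_lin koszul_linear)
  also have "\<dots> = 0 + 0"
    using assms * unfolding is_even_cocycle2_def by (intro arg_cong2[where f = "(+)"]) blast+
  finally show "?c (\<lambda>u v. \<phi> u v + \<psi> u v) = 0" by simp
qed

lemma cocycle2_scale:
  assumes "is_even_cocycle2 scale V br \<phi>"
  shows "is_even_cocycle2 scale V br (\<lambda>u v. scale r (\<phi> u v))"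
  unfolding is_even_cocycle2_def
proof (intro conjI allI ballI)
  show "even_bilinear scale V (\<lambda>u v. scale r (\<phi> u v))"
    using assms by (auto simp: is_even_cocycle2_def intro: even_bilinear_scale)
next
  fix a b c u v w
  assume *: "u \<in> V a" "v \<in> V b" "w \<in> V c"
  let ?c = "\<lambda>\<phi>. br u (\<phi> v w) - br (\<phi> u v) w + koszul b c (br (\<phi> u w) v)
      + \<phi> u (br v w) - \<phi> (br u v) w + koszul b c (\<phi> (br u w) v)"
  have "?c (\<lambda>u v. scale r (\<phi> u v)) = scale r (?c \<phi>)"
    by (simp add: br_lin koszul_linear scale_right_distrib scale_right_diff_distrib)
  also have "\<dots> = scale r 0"
    using assms * unfolding is_even_cocycle2_def by (intro arg_cong[where f = "scale r"]) blast
  finally show "?c (\<lambda>u v. scale r (\<phi> u v)) = 0" by simp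
qed

lemma vectorspace_ZL2_even: "vectorspace class_ring (ZL2_even scale V br)"
proof (rule vs_criteria)
  show "\<forall>\<phi>\<in>carrier (ZL2_even scale V br). \<exists>\<psi>\<in>carrier (ZL2_even scale V br).
      \<phi> \<oplus>\<^bsub>ZL2_even scale V br\<^esub> \<psi> = \<zero>\<^bsub>ZL2_even scale V br\<^esub>"
  proof
    fix \<phi> assume "\<phi> \<in> carrier (ZL2_even scale V br)"
    then show "\<exists>\<psi>\<in>carrier (ZL2_even scale V br).
        \<phi> \<oplus>\<^bsub>ZL2_even scale V br\<^esub> \<psi> = \<zero>\<^bsub>ZL2_even scale V br\<^esub>"
      by (intro bexI[of _ "\<lambda>u v. scale (- 1) (\<phi> u v)"])
        (auto simp: ZL2_even_def intro!: cocycle2_scale[of _ "- 1", simplified])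
  qed
qed (auto simp: ZL2_even_def cocycle2_0 cocycle2_add cocycle2_scale algebra_simps
    scale_left_distrib scale_right_distrib class_field.field_axioms)

lemma d1_cocycle2:
  assumes f: "even_linear scale V f"
  shows "is_even_cocycle2 scale V br (d1 br f)"
proof -
  interpret f: Vector_Spaces.linear scale scale f
    using f by (auto simp: even_linear_def)
  note lin = br_lin f.add f.diff f.neg f.zero f.scale
  have fV: "f u \<in> V a" if "u \<in> V a" for u a
    using f that by (auto simp: even_linear_def)
  have brV: "br u v \<in> V (a + b)" if "u \<in> V a" "v \<in> V b" for u v a b
    using br_even that unfolding even_bilinear_def by blast
  have "bilinear_over scale (d1 br f)"
    by (rule bilinear_overI)
      (simp_all add: d1_def lin algebra_simps scale_right_distrib scale_right_diff_distrib)
  then have "even_bilinear scale V (d1 br f)"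
    unfolding even_bilinear_def d1_def by (intro conjI allI ballI V_closed brV fV)
  moreover have "br u (d1 br f v w) - br (d1 br f u v) w + koszul b c (br (d1 br f u w) v)
      + d1 br f u (br v w) - d1 br f (br u v) w + koszul b c (d1 br f (br u w) v) = 0"
    if *: "u \<in> V a" "v \<in> V b" "w \<in> V c" for a b c u v w
  proof -
    note L = leibniz[OF *] leibniz[OF fV[OF *(1)] *(2,3)] leibniz[OF *(1) fV[OF *(2)] *(3)]
      leibniz[OF *(1,2) fV[OF *(3)]]
    have fL: "f (br u (br v w)) = f (br (br u v) w) - koszul b c (f (br (br u w) v))"
      using L(1) by (auto simp: koszul_def lin)
    show ?thesis
      by (cases "b = 1 \<and> c = 1") (auto simp: d1_def lin L fL koszul_def)
  qed
  ultimately show ?thesis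
    by (simp add: is_even_cocycle2_def)
qed

lemma subspace_BL2_even: "VectorSpace.subspace class_ring (BL2_even scale V br) (ZL2_even scale V br)"
proof (intro VectorSpace.subspace.intro LinearCombinations.submodule.intro vectorspace_ZL2_even)
  show "Module.module class_ring (ZL2_even scale V br)"
    using vectorspace_ZL2_even by (simp add: vectorspace_def)
  show "BL2_even scale V br \<subseteq> carrier (ZL2_even scale V br)"
    by (auto simp: BL2_even_def ZL2_even_def d1_cocycle2)
next
  fix \<phi> \<psi> assume "\<phi> \<in> BL2_even scale V br" "\<psi> \<in> BL2_even scale V br"
  then obtain f g where fg: "even_linear scale V f" "even_linear scale V g"
      "\<phi> = d1 br f" "\<psi> = d1 br g"
    by (auto simp: BL2_even_def)
  interpret f: Vector_Spaces.linear scale scale f using fg by (auto simp: even_linear_def)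
  interpret g: Vector_Spaces.linear scale scale g using fg by (auto simp: even_linear_def)
  have "even_linear scale V (\<lambda>u. f u + g u)"
    using fg by (auto simp: even_linear_def f.add g.add f.scale g.scale scale_right_distrib
        intro!: V_closed linear_overI)
  moreover have "(\<lambda>u v. \<phi> u v + \<psi> u v) = d1 br (\<lambda>u. f u + g u)"
    by (auto simp: fun_eq_iff fg d1_def br_lin)
  ultimately show "\<phi> \<oplus>\<^bsub>ZL2_even scale V br\<^esub> \<psi> \<in> BL2_even scale V br"
    by (auto simp: BL2_even_def ZL2_even_def)
next
  have "even_linear scale V (\<lambda>u. 0)"
    by (auto simp: even_linear_def intro!: V_closed linear_overI)
  moreover have "(\<lambda>u v. 0) = d1 br (\<lambda>u. 0)"
    by (auto simp: fun_eq_iff d1_def br_lin)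
  ultimately show "\<zero>\<^bsub>ZL2_even scale V br\<^esub> \<in> BL2_even scale V br"
    by (auto simp: BL2_even_def ZL2_even_def)
next
  fix c :: 'a and \<phi> assume "\<phi> \<in> BL2_even scale V br"
  then obtain f where f: "even_linear scale V f" "\<phi> = d1 br f"
    by (auto simp: BL2_even_def)
  interpret f: Vector_Spaces.linear scale scale f using f by (auto simp: even_linear_def)
  have "even_linear scale V (\<lambda>u. scale c (f u))"
    using f by (auto simp: even_linear_def f.add f.scale scale_right_distrib mult.commute
        intro!: V_closed linear_overI)
  moreover have "(\<lambda>u v. scale c (\<phi> u v)) = d1 br (\<lambda>u. scale c (f u))"
    by (auto simp: fun_eq_iff f d1_def br_lin scale_right_distrib scale_right_diff_distrib)
  ultimately show "c \<odot>\<^bsub>ZL2_even scale V br\<^esub> \<phi> \<in> BL2_even scale V br"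
    by (auto simp: BL2_even_def ZL2_even_def)
qed

theorem vectorspace_HL2_even: "vectorspace class_ring (HL2_even scale V br)"
  unfolding HL2_even_def
  by (rule vectorspace.vectorspace_quotient_module[OF vectorspace_ZL2_even subspace_BL2_even])

end

section \<open>The null-filiform superalgebra\<close>

text \<open>The whole type \<open>'v\<close> is the underlying space of \<open>NF\<^sup>n\<^sup>,\<^sup>n\<close>, with basis
  \<open>x 1, \<dots>, x n, y 1, \<dots>, y n\<close>; values of \<open>x\<close> and \<open>y\<close> at other indices are irrelevant.\<close>

locale nf_basis = vector_space scale
  for scale :: "'a::field_char_0 \<Rightarrow> 'v::ab_group_add \<Rightarrow> 'v" +
  fixes n :: nat and x y :: "nat \<Rightarrow> 'v"
  assumes inj_x: "inj_on x {1..n}"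
    and inj_y: "inj_on y {1..n}"
    and x_y_disjoint: "x ` {1..n} \<inter> y ` {1..n} = {}"
    and independent_basis: "independent (x ` {1..n} \<union> y ` {1..n})"
    and span_basis: "span (x ` {1..n} \<union> y ` {1..n}) = UNIV"
begin

abbreviation basis_vectors :: "'v set" where
  "basis_vectors \<equiv> x ` {1..n} \<union> y ` {1..n}"

definition grading :: "bit \<Rightarrow> 'v set" where
  "grading a = span ((if a = 0 then x else y) ` {1..n})"

abbreviation coord :: "'v \<Rightarrow> 'v \<Rightarrow> 'a" where
  "coord \<equiv> representation basis_vectors"

text \<open>The bilinear extension of the table of values on pairs of basis vectors;
  see \<open>psi_basis\<close> and \<open>psi_unique\<close> below.\<close>

definition psi :: "nat \<Rightarrow> 'v \<Rightarrow> 'v \<Rightarrow> 'v" where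
  "psi k u v =
    scale (coord u (x n) * coord v (y 1)) (y k)
    + scale (coord u (x n) * coord v (x 1)) (scale 2 (x k))
    + scale (coord u (y n) * coord v (x 1)) (scale 2 (y k))"

end

context nf_basis
begin

context
  notes One_nat_def [simp del] and atLeastAtMost_iff [simp del] and Un_iff [simp del]
begin

lemma x_eq_iff: "i \<in> {1..n} \<Longrightarrow> j \<in> {1..n} \<Longrightarrow> x i = x j \<longleftrightarrow> i = j"
  using inj_x by (auto simp: inj_on_def)

lemma y_eq_iff: "i \<in> {1..n} \<Longrightarrow> j \<in> {1..n} \<Longrightarrow> y i = y j \<longleftrightarrow> i = j"
  using inj_y by (auto simp: inj_on_def)

lemma x_neq_y: "i \<in> {1..n} \<Longrightarrow> j \<in> {1..n} \<Longrightarrow> x i \<noteq> y j"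
  using x_y_disjoint by blast

lemma x_in: "i \<in> {1..n} \<Longrightarrow> x i \<in> basis_vectors" and y_in: "i \<in> {1..n} \<Longrightarrow> y i \<in> basis_vectors"
  by blast+

lemma coord_basis: "b \<in> basis_vectors \<Longrightarrow> coord b c = (if c = b then 1 else 0)"
  by (simp only: representation_basis[OF independent_basis])

lemma coord_add: "coord (u + v) b = coord u b + coord v b"
  by (simp only: representation_add[OF independent_basis] span_basis UNIV_I)

lemma coord_scale: "coord (scale c u) b = c * coord u b"
  by (simp only: representation_scale[OF independent_basis] span_basis UNIV_I)

lemma bilinear_over_eqI:
  assumes "bilinear_over scale \<phi>" "bilinear_over scale \<psi>"
    and "\<And>b c. b \<in> basis_vectors \<Longrightarrow> c \<in> basis_vectors \<Longrightarrow> \<phi> b c = \<psi> b c"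
  shows "\<phi> = \<psi>"
proof -
  note l = bilinear_over_left[OF assms(1)] bilinear_over_left[OF assms(2)]
    bilinear_over_right[OF assms(1)] bilinear_over_right[OF assms(2)]
  have 1: "\<phi> u c = \<psi> u c" if c: "c \<in> basis_vectors" for u c
  proof -
    have "u \<in> span basis_vectors" by (simp add: span_basis)
    then show ?thesis
    proof (rule span_induct)
      show "subspace {u. \<phi> u c = \<psi> u c}"
        by (rule subspaceI) (simp_all add: l)
    qed (simp add: assms(3) c)
  qed
  have "\<phi> u v = \<psi> u v" for u v
  proof -
    have "v \<in> span basis_vectors" by (simp add: span_basis)
    then show ?thesis
    proof (rule span_induct)
      show "subspace {v. \<phi> u v = \<psi> u v}"
        by (rule subspaceI) (simp_all add: l)
    qed (simp add: 1)
  qed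
  then show ?thesis by blast
qed

lemma psi_bilinear: "bilinear_over scale (psi k)"
  by (rule bilinear_overI)
    (simp_all add: psi_def coord_add coord_scale distrib_left distrib_right scale_left_distrib
      scale_right_distrib mult_ac add_ac)

lemma psi_basis:
  assumes "i \<in> {1..n}" "j \<in> {1..n}"
  shows "psi k (x i) (y j) = (if i = n \<and> j = 1 then y k else 0)"
    and "psi k (x i) (x j) = (if i = n \<and> j = 1 then scale 2 (x k) else 0)"
    and "psi k (y i) (x j) = (if i = n \<and> j = 1 then scale 2 (y k) else 0)"
    and "psi k (y i) (y j) = 0"
proof -
  have n: "1 \<in> {1..n}" "n \<in> {1..n}" using assms by (auto simp: atLeastAtMost_iff)
  have x: "coord (x l) (x m) = (if m = l then 1 else 0)" "coord (x l) (y m) = 0"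
    if "l \<in> {1..n}" "m \<in> {1..n}" for l m
    using that by (simp_all add: coord_basis x_in x_eq_iff x_neq_y[symmetric])
  have y: "coord (y l) (y m) = (if m = l then 1 else 0)" "coord (y l) (x m) = 0"
    if "l \<in> {1..n}" "m \<in> {1..n}" for l m
    using that by (simp_all add: coord_basis y_in y_eq_iff x_neq_y)
  show "psi k (x i) (y j) = (if i = n \<and> j = 1 then y k else 0)"
    and "psi k (x i) (x j) = (if i = n \<and> j = 1 then scale 2 (x k) else 0)"
    and "psi k (y i) (x j) = (if i = n \<and> j = 1 then scale 2 (y k) else 0)"
    and "psi k (y i) (y j) = 0"
    using assms n by (simp_all add: psi_def x y)
qed

lemma psi_unique:
  assumes "bilinear_over scale \<phi>"
    and "\<And>i j. \<lbrakk>i \<in> {1..n}; j \<in> {1..n}\<rbrakk> \<Longrightarrow>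
      \<phi> (x i) (y j) = (if i = n \<and> j = 1 then y k else 0)"
    and "\<And>i j. \<lbrakk>i \<in> {1..n}; j \<in> {1..n}\<rbrakk> \<Longrightarrow>
      \<phi> (x i) (x j) = (if i = n \<and> j = 1 then scale 2 (x k) else 0)"
    and "\<And>i j. \<lbrakk>i \<in> {1..n}; j \<in> {1..n}\<rbrakk> \<Longrightarrow>
      \<phi> (y i) (x j) = (if i = n \<and> j = 1 then scale 2 (y k) else 0)"
    and "\<And>i j. \<lbrakk>i \<in> {1..n}; j \<in> {1..n}\<rbrakk> \<Longrightarrow> \<phi> (y i) (y j) = 0"
  shows "\<phi> = psi k"
proof (rule bilinear_over_eqI[OF assms(1) psi_bilinear])
  fix b c assume "b \<in> basis_vectors" "c \<in> basis_vectors"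
  then show "\<phi> b c = psi k b c"
    by (elim UnE imageE) (simp_all only: assms(2-) psi_basis)
qed

lemma bilinear_extension_exists:
  "\<exists>\<phi>. bilinear_over scale \<phi> \<and> (\<forall>b\<in>basis_vectors. \<forall>c\<in>basis_vectors. \<phi> b c = g b c)"
proof (intro exI conjI ballI)
  let ?\<phi> = "\<lambda>u v. \<Sum>b\<in>basis_vectors. \<Sum>c\<in>basis_vectors. scale (coord u b * coord v c) (g b c)"
  show "bilinear_over scale ?\<phi>"
    by (rule bilinear_overI)
      (simp_all add: coord_add coord_scale distrib_left distrib_right scale_left_distrib
        sum.distrib scale_sum_right mult_ac)
  fix b c assume bc: "b \<in> basis_vectors" "c \<in> basis_vectors"
  have "?\<phi> b c = (\<Sum>b'\<in>basis_vectors. \<Sum>c'\<in>basis_vectors.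
      if c' = c then if b' = b then g b c else 0 else 0)"
    by (intro sum.cong refl) (simp add: coord_basis bc)
  also have "\<dots> = g b c"
    using bc by (simp add: sum.delta)
  finally show "?\<phi> b c = g b c" .
qed

lemma span_x_Int_span_y: "span (x ` {1..n}) \<inter> span (y ` {1..n}) = {0}"
proof -
  have "u = 0" if u: "u \<in> span (x ` {1..n})" "u \<in> span (y ` {1..n})" for u
  proof -
    have x: "coord u = representation (x ` {1..n}) u"
      by (rule representation_extend[OF independent_basis u(1)]) blast
    have y: "coord u = representation (y ` {1..n}) u"
      by (rule representation_extend[OF independent_basis u(2)]) blast
    have "coord u b = 0" for b
    proof (rule ccontr)
      assume "coord u b \<noteq> 0"
      then have "b \<in> x ` {1..n}" "b \<in> y ` {1..n}"
        using representation_ne_zero x y by metis+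
      then show False using x_y_disjoint by blast
    qed
    moreover have "(\<Sum>b | coord u b \<noteq> 0. scale (coord u b) b) = u"
      by (rule sum_nonzero_representation_eq[OF independent_basis]) (simp add: span_basis)
    ultimately show "u = 0" by simp
  qed
  then show ?thesis using span_zero by blast
qed

end

end


locale null_filiform = nf_basis scale n x y
  for scale :: "'a::field_char_0 \<Rightarrow> 'v::ab_group_add \<Rightarrow> 'v" and n x y +
  fixes br :: "'v \<Rightarrow> 'v \<Rightarrow> 'v"
  assumes br_bilinear: "bilinear_over scale br"
    and br_y_y: "\<lbrakk>i \<in> {1..n}; j \<in> {1..n}\<rbrakk> \<Longrightarrow>
      br (y i) (y j) = (if j = 1 then x i else 0)"
    and br_x_y: "\<lbrakk>i \<in> {1..n}; j \<in> {1..n}\<rbrakk> \<Longrightarrow>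
      br (x i) (y j) = (if j = 1 \<and> i < n then scale (1/2) (y (i + 1)) else 0)"
    and br_y_x: "\<lbrakk>i \<in> {1..n}; j \<in> {1..n}\<rbrakk> \<Longrightarrow>
      br (y i) (x j) = (if j = 1 \<and> i < n then y (i + 1) else 0)"
    and br_x_x: "\<lbrakk>i \<in> {1..n}; j \<in> {1..n}\<rbrakk> \<Longrightarrow>
      br (x i) (x j) = (if j = 1 \<and> i < n then x (i + 1) else 0)"

theorem (in nf_basis) null_filiform_exists: "\<exists>br. null_filiform scale n x y br"
proof -
  define ix where "ix = the_inv_into {1..n} x"
  define iy where "iy = the_inv_into {1..n} y"
  have ix: "ix (x i) = i" and iy: "iy (y i) = i" if "i \<in> {1..n}" for i
    using that the_inv_into_f_f[OF inj_x] the_inv_into_f_f[OF inj_y] by (auto simp: ix_def iy_def)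
  have xI: "x i \<in> x ` {1..n}" "x i \<notin> y ` {1..n}" and yI: "y i \<in> y ` {1..n}" "y i \<notin> x ` {1..n}"
    if "i \<in> {1..n}" for i
    using that x_y_disjoint by blast+
  define g where "g b c = (if b \<in> x ` {1..n}
      then if c \<in> x ` {1..n}
        then if ix c = 1 \<and> ix b < n then x (ix b + 1) else 0
        else if iy c = 1 \<and> ix b < n then scale (1/2) (y (ix b + 1)) else 0
      else if c \<in> x ` {1..n}
        then if ix c = 1 \<and> iy b < n then y (iy b + 1) else 0
        else if iy c = 1 then x (iy b) else 0)" for b c
  obtain br where br: "bilinear_over scale br"
    "\<forall>b\<in>basis_vectors. \<forall>c\<in>basis_vectors. br b c = g b c"
    using bilinear_extension_exists by blast
  have "null_filiform scale n x y br"
  proof (intro null_filiform.intro null_filiform_axioms.intro)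
    show "nf_basis scale n x y" by (rule nf_basis_axioms)
    show "bilinear_over scale br" by (rule br(1))
  qed (simp_all only: br(2)[rule_format, OF x_in x_in] br(2)[rule_format, OF x_in y_in]
      br(2)[rule_format, OF y_in x_in] br(2)[rule_format, OF y_in y_in]
      g_def xI yI ix iy if_True if_False)
  then show ?thesis by blast
qed

theorem (in null_filiform) is_leibniz_superalgebra: "leibniz_superalgebra scale grading br"
proof -
  define e where "e a = (if a = 0 then x else y)" for a :: bit
  have e01: "e 0 = x" "e 1 = y" by (simp_all add: e_def)
  have gr: "grading a = span (e a ` {1..n})" for a by (simp add: grading_def e_def)
  note lin = bilinear_over_left[OF br_bilinear] bilinear_over_right[OF br_bilinear]
  have koszul_lin: "koszul b c (u + v) = koszul b c u + koszul b c v"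
    "koszul b c (scale r u) = scale r (koszul b c u)" "koszul b c 0 = 0" for b c r and u v :: 'v
    by (simp_all add: koszul_def)
  note prods = br_x_x br_x_y br_y_x br_y_y
  have in_grading: "e a i \<in> grading a" if "i \<in> {1..n}" for a i
    unfolding gr using that by (intro span_base imageI)
  have grading_closed: "0 \<in> grading a" "u \<in> grading a \<Longrightarrow> v \<in> grading a \<Longrightarrow> u + v \<in> grading a"
    "u \<in> grading a \<Longrightarrow> scale r u \<in> grading a" for a u v r
    by (auto simp: gr intro: span_zero span_add span_scale)
  have basis_grading: "br (e a i) (e b j) \<in> grading (a + b)"
    if ij: "i \<in> {1..n}" "j \<in> {1..n}" for a b i j
  proof -
    have "i + 1 \<in> {1..n}" if "i < n" using that by simp
    note 1 = in_grading[OF ij(1), of 0] in_grading[OF this, of 0] in_grading[OF this, of 1]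
    show ?thesis
      using 1 grading_closed unfolding e01
      by (cases a; cases b) (auto simp: e01 prods ij simp del: One_nat_def atLeastAtMost_iff)
  qed
  have graded: "br u v \<in> grading (a + b)" if u: "u \<in> grading a" and v: "v \<in> grading b" for a b u v
  proof -
    have 1: "br (e a i) v \<in> grading (a + b)" if i: "i \<in> {1..n}" for i
      using v unfolding gr[of b]
    proof (rule span_induct)
      show "subspace {v. br (e a i) v \<in> grading (a + b)}"
        by (rule subspaceI) (simp_all only: mem_Collect_eq lin grading_closed)
    qed (use basis_grading i in blast)
    from u show ?thesis unfolding gr[of a]
    proof (rule span_induct)
      show "subspace {u. br u v \<in> grading (a + b)}"
        by (rule subspaceI) (simp_all only: mem_Collect_eq lin grading_closed)
    qed (use 1 in blast)
  qed
  have basis_leibniz: "br (e a i) (br (e b j) (e c l))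
      = br (br (e a i) (e b j)) (e c l) - koszul b c (br (br (e a i) (e c l)) (e b j))"
    if ijl: "i \<in> {1..n}" "j \<in> {1..n}" "l \<in> {1..n}" for a b c i j l
  proof -
    have 1: "k + 1 \<in> {1..n}" if "k < n" for k using that by simp
    have 2: "scale (1/2) u + scale (1/2) u = u" for u
      by (simp flip: scale_left_distrib)
    have "1 \<in> {1..n}" "j \<noteq> 0" using ijl by simp_all
    then show ?thesis
      by (cases a; cases b; cases c)
        (auto simp: e01 prods lin ijl 1 2 koszul_def simp del: One_nat_def atLeastAtMost_iff)
  qed
  have leib: "br u (br v w) = br (br u v) w - koszul b c (br (br u w) v)"
    if u: "u \<in> grading a" and v: "v \<in> grading b" and w: "w \<in> grading c" for a b c u v w
  proof -
    have 1: "br (e a i) (br (e b j) w) = br (br (e a i) (e b j)) w - koszul b c (br (br (e a i) w) (e b j))"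
      if ij: "i \<in> {1..n}" "j \<in> {1..n}" for i j
      using w unfolding gr[of c]
    proof (rule span_induct)
      show "subspace {w. br (e a i) (br (e b j) w)
          = br (br (e a i) (e b j)) w - koszul b c (br (br (e a i) w) (e b j))}"
        by (rule subspaceI) (simp_all add: lin koszul_lin scale_right_diff_distrib)
    qed (use basis_leibniz ij in blast)
    have 2: "br (e a i) (br v w) = br (br (e a i) v) w - koszul b c (br (br (e a i) w) v)"
      if i: "i \<in> {1..n}" for i
      using v unfolding gr[of b]
    proof (rule span_induct)
      show "subspace {v. br (e a i) (br v w)
          = br (br (e a i) v) w - koszul b c (br (br (e a i) w) v)}"
        by (rule subspaceI) (simp_all add: lin koszul_lin scale_right_diff_distrib)
    qed (use 1 i in blast)
    from u show ?thesis unfolding gr[of a]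
    proof (rule span_induct)
      show "subspace {u. br u (br v w) = br (br u v) w - koszul b c (br (br u w) v)}"
        by (rule subspaceI) (simp_all add: lin koszul_lin scale_right_diff_distrib)
    qed (use 2 in blast)
  qed
  show ?thesis
  proof unfold_locales
    show "subspace (grading a)" for a by (simp add: gr)
    show "grading 0 \<inter> grading 1 = {0}"
      unfolding gr e01 by (rule span_x_Int_span_y)
    show "\<exists>v\<in>grading 0. \<exists>w\<in>grading 1. u = v + w" for u
      using span_basis span_Un[of "x ` {1..n}" "y ` {1..n}"] unfolding gr e01 by blast
    show "even_bilinear scale grading br"
      unfolding even_bilinear_def using br_bilinear graded by blast
  qed (rule leib)
qed

end

theory Submission
  imports Defs
begin

text \<open>Let \<open>R\<close> be right multiplication by \<open>y 1\<close>. The vectors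
  \<open>e m = R\<^sup>m (y 1)\<close> for \<open>m < 2 n\<close> are, up to powers of two, the given basis, and
  \<open>[u, e 1] = 2 R\<^sup>2 u\<close>, \<open>[u, e m] = 0\<close> for \<open>m \<ge> 2\<close>. The cocycle identity for
  \<open>(u, e m, y 1)\<close> expresses \<open>\<phi> u (e (m + 1))\<close> through \<open>\<phi> _ (e m)\<close> and \<open>\<phi> _ (y 1)\<close>, so a cocycle
  is determined by the linear map \<open>u \<mapsto> \<phi> u (y 1)\<close>. Subtracting \<open>d1 f\<close>, where \<open>f (e m)\<close> is defined
  recursively, makes this map vanish on \<open>e m\<close> for \<open>m < 2 n - 1\<close>; its remaining value at \<open>x n\<close> is an
  odd vector annihilated by \<open>[y 1, -]\<close>, because \<open>e (2 n) = 0\<close>, and hence a combination of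
  \<open>y 2, \<dots>, y n\<close>, the values of \<open>psi 2, \<dots>, psi n\<close> up to scaling. Conversely, if \<open>d1 f\<close> vanishes on \<open>(e m, y 1)\<close> for
  \<open>m < 2 n - 1\<close>, then \<open>f (e m) = R\<^sup>m (f (y 1)) + m b (e m)\<close> with \<open>b\<close> the \<open>y 1\<close>-coordinate of
  \<open>f (y 1)\<close>, and nilpotency of \<open>R\<close> makes \<open>d1 f\<close> vanish on \<open>(x n, y 1)\<close> as well.\<close>

section \<open>Bases of quotient spaces\<close>

lemma (in mod_hom) hom_finsum:
  assumes "g \<in> I \<rightarrow> carrier M"
  shows "f (\<Oplus>\<^bsub>M\<^esub>i\<in>I. g i) = (\<Oplus>\<^bsub>N\<^esub>i\<in>I. f (g i))"
  using assms
proof (induct I rule: infinite_finite_induct)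
  case (insert i I)
  then have "(\<Oplus>\<^bsub>N\<^esub>i\<in>insert i I. f (g i)) = f (g i) \<oplus>\<^bsub>N\<^esub> (\<Oplus>\<^bsub>N\<^esub>i\<in>I. f (g i))"
    by (intro N.M.finsum_insert) auto
  with insert show ?case by simp
qed auto

context vectorspace
begin

text \<open>Bases in the library are sets, while the classes form an indexed family. Independence
  over the index set also excludes repeated vectors, hence the first conclusion.\<close>

lemma indexed_basisI:
  assumes I: "finite I" and w: "w \<in> I \<rightarrow> carrier V"
    and indep: "\<And>c. c \<in> I \<rightarrow> carrier K \<Longrightarrow> (\<Oplus>\<^bsub>V\<^esub>i\<in>I. c i \<odot>\<^bsub>V\<^esub> w i) = \<zero>\<^bsub>V\<^esub> \<Longrightarrow> \<forall>i\<in>I. c i = \<zero>\<^bsub>K\<^esub>"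
    and gen: "\<And>v. v \<in> carrier V \<Longrightarrow> \<exists>c\<in>I \<rightarrow> carrier K. v = (\<Oplus>\<^bsub>V\<^esub>i\<in>I. c i \<odot>\<^bsub>V\<^esub> w i)"
  shows "inj_on w I" and "basis (w ` I)"
proof -
  show inj: "inj_on w I"
  proof (rule inj_onI, rule ccontr)
    fix i j assume ij: "i \<in> I" "j \<in> I" "w i = w j" "i \<noteq> j"
    \<comment> \<open>If \<open>w i\<close> and \<open>w j\<close> agree, the coefficients 1 at
      \<open>i\<close> and -1 at \<open>j\<close> give a nontrivial relation.\<close>
    define c where "c k = (if k = i then \<one>\<^bsub>K\<^esub> else if k = j then \<ominus>\<^bsub>K\<^esub> \<one>\<^bsub>K\<^esub> else \<zero>\<^bsub>K\<^esub>)" for k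
    have c: "c \<in> I \<rightarrow> carrier K" by (auto simp: c_def)
    have rest: "(\<Oplus>\<^bsub>V\<^esub>k\<in>I - {i, j}. c k \<odot>\<^bsub>V\<^esub> w k) = \<zero>\<^bsub>V\<^esub>"
      using w by (intro M.add.finprod_one_eqI) (auto simp: c_def Pi_iff)
    have "(\<Oplus>\<^bsub>V\<^esub>k\<in>I. c k \<odot>\<^bsub>V\<^esub> w k)
        = (\<Oplus>\<^bsub>V\<^esub>k\<in>insert i (insert j (I - {i, j})). c k \<odot>\<^bsub>V\<^esub> w k)"
      using ij by (intro arg_cong[where f = "finsum V _"]) auto
    also have "\<dots> = c i \<odot>\<^bsub>V\<^esub> w i \<oplus>\<^bsub>V\<^esub> (c j \<odot>\<^bsub>V\<^esub> w j \<oplus>\<^bsub>V\<^esub> (\<Oplus>\<^bsub>V\<^esub>k\<in>I - {i, j}. c k \<odot>\<^bsub>V\<^esub> w k))"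
    proof -
      have [simp]: "w i \<in> carrier V" "w j \<in> carrier V" "c i \<in> carrier K" "c j \<in> carrier K"
        "(\<lambda>k. c k \<odot>\<^bsub>V\<^esub> w k) \<in> I - {i, j} \<rightarrow> carrier V"
        using w c ij by auto
      show ?thesis using I ij(4)
        by (simp add: M.finsum_insert)
    qed
    also have "\<dots> = \<zero>\<^bsub>V\<^esub>"
    proof -
      have "w j \<in> carrier V" using w ij by auto
      then show ?thesis unfolding rest using ij(3,4) by (simp add: c_def smult_l_minus M.r_neg)
    qed
    finally have "c i = \<zero>\<^bsub>K\<^esub>"
      using indep[OF c] ij by blast
    then show False by (simp add: c_def)
  qed
  have sub: "w ` I \<subseteq> carrier V" using w by auto
  have lincomb: "lincomb a (w ` I) = (\<Oplus>\<^bsub>V\<^esub>i\<in>I. a (w i) \<odot>\<^bsub>V\<^esub> w i)"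
    if "a \<in> w ` I \<rightarrow> carrier K" for a
    unfolding lincomb_def using that w inj by (subst M.finsum_reindex) auto
  have "lin_indpt (w ` I)"
  proof (rule finite_lin_indpt2[OF _ sub])
    fix a assume a: "a \<in> w ` I \<rightarrow> carrier K" "lincomb a (w ` I) = \<zero>\<^bsub>V\<^esub>"
    then show "\<forall>v\<in>w ` I. a v = \<zero>\<^bsub>K\<^esub>"
    proof -
      have "(\<lambda>i. a (w i)) \<in> I \<rightarrow> carrier K" using a(1) by auto
      moreover have "(\<Oplus>\<^bsub>V\<^esub>i\<in>I. a (w i) \<odot>\<^bsub>V\<^esub> w i) = \<zero>\<^bsub>V\<^esub>" using a lincomb by simp
      ultimately show ?thesis using indep[of "\<lambda>i. a (w i)"] by blast
    qed
  qed (use I in simp)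
  moreover have "gen_set (w ` I)"
  proof
    show "carrier V \<subseteq> span (w ` I)"
    proof
      fix v assume "v \<in> carrier V"
      then obtain c where c: "c \<in> I \<rightarrow> carrier K" "v = (\<Oplus>\<^bsub>V\<^esub>i\<in>I. c i \<odot>\<^bsub>V\<^esub> w i)"
        using gen by blast
      define a where "a = c \<circ> the_inv_into I w"
      have a: "a \<in> w ` I \<rightarrow> carrier K"
        using c inj by (auto simp: a_def the_inv_into_f_f)
      have "v = lincomb a (w ` I)"
        unfolding lincomb[OF a] c(2) using c(1) w inj
        by (intro M.finsum_cong') (auto simp: a_def the_inv_into_f_f Pi_iff)
      then show "v \<in> span (w ` I)"
        using finite_span[OF _ sub] I a by auto
    qed
  qed (rule span_is_subset2[OF sub])
  ultimately show "basis (w ` I)"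
    using sub by (simp add: basis_def)
qed

text \<open>Opens the additive coset calculus to subspaces. Negatives stay in \<open>N\<close>
  because they are multiples by minus one.\<close>

lemma subspace_abelian_subgroup:
  assumes "subspace K N V"
  shows "abelian_subgroup N V"
proof (rule abelian_subgroupI3[OF _ M.abelian_group_axioms])
  interpret S: submodule K N V
    using assms by (simp add: subspace_def)
  have "inv\<^bsub>add_monoid V\<^esub> h \<in> N" if "h \<in> N" for h
  proof -
    have "\<ominus>\<^bsub>V\<^esub> h = (\<ominus>\<^bsub>K\<^esub> \<one>\<^bsub>K\<^esub>) \<odot>\<^bsub>V\<^esub> h"
      using that S.subset by (simp add: smult_l_minus subset_iff)
    also have "\<dots> \<in> N"
      using that by simp
    finally show ?thesis by (simp add: a_inv_def)
  qed
  then show "additive_subgroup N V"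
    using S.subset by (intro additive_subgroup.intro subgroup.intro) auto
qed

text \<open>The scalar action on a coset is a union over all its representatives. Two
  representatives differ by an element of \<open>N\<close>, which scaling keeps in \<open>N\<close>,
  so every member of this union is the same coset.\<close>

lemma quotient_projection:
  assumes N: "subspace K N V"
  shows "mod_hom K V (quotient_module V N) (\<lambda>u. N +>\<^bsub>V\<^esub> u)"
proof -
  interpret N: abelian_subgroup N V by (rule subspace_abelian_subgroup[OF N])
  interpret S: submodule K N V using N by (simp add: subspace_def)
  interpret W: vectorspace K "quotient_module V N" by (rule vectorspace_quotient_module[OF N])
  have smult: "N +>\<^bsub>V\<^esub> (c \<odot>\<^bsub>V\<^esub> w) = N +>\<^bsub>V\<^esub> (c \<odot>\<^bsub>V\<^esub> u)"
    if u: "u \<in> carrier V" and c: "c \<in> carrier K" and w: "w \<in> N +>\<^bsub>V\<^esub> u" for u c w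
  proof -
    obtain h where h: "h \<in> N" "w = h \<oplus>\<^bsub>V\<^esub> u"
      using w by (auto simp: a_r_coset_def')
    then have "c \<odot>\<^bsub>V\<^esub> w = c \<odot>\<^bsub>V\<^esub> h \<oplus>\<^bsub>V\<^esub> c \<odot>\<^bsub>V\<^esub> u"
      using u c S.subset by (auto simp: smult_r_distr subset_iff)
    then have "c \<odot>\<^bsub>V\<^esub> w \<in> N +>\<^bsub>V\<^esub> (c \<odot>\<^bsub>V\<^esub> u)"
      using h c by (auto simp: a_r_coset_def')
    then show ?thesis
      using a_repr_independence[OF _ _ N.a_subgroup] u c by simp
  qed
  have "(\<lambda>u. N +>\<^bsub>V\<^esub> u) \<in> LinearCombinations.module_hom K V (quotient_module V N)"
    unfolding LinearCombinations.module_hom_def mem_Collect_eq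
  proof (intro conjI allI impI; (elim conjE)?)
    show "(\<lambda>u. N +>\<^bsub>V\<^esub> u) \<in> carrier V \<rightarrow> carrier (quotient_module V N)"
      by (auto simp: quotient_module_def A_RCOSETS_def')
    show "N +>\<^bsub>V\<^esub> (u \<oplus>\<^bsub>V\<^esub> v) = (N +>\<^bsub>V\<^esub> u) \<oplus>\<^bsub>quotient_module V N\<^esub> (N +>\<^bsub>V\<^esub> v)"
      if "u \<in> carrier V" "v \<in> carrier V" for u v
      using that by (simp add: quotient_module_def N.a_rcos_sum)
    show "N +>\<^bsub>V\<^esub> (c \<odot>\<^bsub>V\<^esub> u) = c \<odot>\<^bsub>quotient_module V N\<^esub> (N +>\<^bsub>V\<^esub> u)"
      if "c \<in> carrier K" "u \<in> carrier V" for c u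
    proof -
      have "(\<Union>w\<in>N +>\<^bsub>V\<^esub> u. N +>\<^bsub>V\<^esub> (c \<odot>\<^bsub>V\<^esub> w)) = N +>\<^bsub>V\<^esub> (c \<odot>\<^bsub>V\<^esub> u)"
        using smult[OF that(2,1)] N.a_rcos_self[OF that(2)] by blast
      then show ?thesis by (simp add: quotient_module_def)
    qed
  qed
  then show ?thesis
    by (intro mod_hom.intro mod_hom_axioms.intro module_axioms W.module_axioms)
qed

text \<open>The projection is linear and the zero of the quotient is \<open>N\<close>. Independence
  and generation modulo \<open>N\<close> therefore become independence and generation for the
  cosets.\<close>

lemma quotient_module_basisI:
  assumes N: "subspace K N V" and I: "finite I" and w: "w \<in> I \<rightarrow> carrier V"
    and indep: "\<And>c. c \<in> I \<rightarrow> carrier K \<Longrightarrow> (\<Oplus>\<^bsub>V\<^esub>i\<in>I. c i \<odot>\<^bsub>V\<^esub> w i) \<in> N \<Longrightarrow> \<forall>i\<in>I. c i = \<zero>\<^bsub>K\<^esub>"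
    and gen: "\<And>v. v \<in> carrier V \<Longrightarrow>
      \<exists>c\<in>I \<rightarrow> carrier K. \<exists>h\<in>N. v = h \<oplus>\<^bsub>V\<^esub> (\<Oplus>\<^bsub>V\<^esub>i\<in>I. c i \<odot>\<^bsub>V\<^esub> w i)"
  shows "inj_on (\<lambda>i. N +>\<^bsub>V\<^esub> w i) I"
    and "vectorspace.basis K (quotient_module V N) ((\<lambda>i. N +>\<^bsub>V\<^esub> w i) ` I)"
proof -
  interpret N: abelian_subgroup N V by (rule subspace_abelian_subgroup[OF N])
  interpret W: vectorspace K "quotient_module V N" by (rule vectorspace_quotient_module[OF N])
  interpret P: mod_hom K V "quotient_module V N" "\<lambda>u. N +>\<^bsub>V\<^esub> u"
    by (rule quotient_projection[OF N])
  have sum: "(\<Oplus>\<^bsub>quotient_module V N\<^esub>i\<in>I. c i \<odot>\<^bsub>quotient_module V N\<^esub> (N +>\<^bsub>V\<^esub> w i))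
      = N +>\<^bsub>V\<^esub> (\<Oplus>\<^bsub>V\<^esub>i\<in>I. c i \<odot>\<^bsub>V\<^esub> w i)" if c: "c \<in> I \<rightarrow> carrier K" for c
  proof -
    have "(\<lambda>i. c i \<odot>\<^bsub>V\<^esub> w i) \<in> I \<rightarrow> carrier V" using c w by auto
    from P.hom_finsum[OF this] show ?thesis
      using c w by (subst W.M.finsum_cong'[where g = "\<lambda>i. N +>\<^bsub>V\<^esub> (c i \<odot>\<^bsub>V\<^esub> w i)"]) (auto simp: Pi_iff)
  qed
  have closed: "(\<Oplus>\<^bsub>V\<^esub>i\<in>I. c i \<odot>\<^bsub>V\<^esub> w i) \<in> carrier V" if "c \<in> I \<rightarrow> carrier K" for c
    using that w by (intro M.finsum_closed) auto
  have zero: "\<zero>\<^bsub>quotient_module V N\<^esub> = N" by (simp add: quotient_module_def)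
  have w': "(\<lambda>i. N +>\<^bsub>V\<^esub> w i) \<in> I \<rightarrow> carrier (quotient_module V N)" using w by auto
  have indep': "\<forall>i\<in>I. c i = \<zero>\<^bsub>K\<^esub>"
    if "c \<in> I \<rightarrow> carrier K" "(\<Oplus>\<^bsub>quotient_module V N\<^esub>i\<in>I. c i \<odot>\<^bsub>quotient_module V N\<^esub> (N +>\<^bsub>V\<^esub> w i))
      = \<zero>\<^bsub>quotient_module V N\<^esub>" for c
  proof -
    have "N +>\<^bsub>V\<^esub> (\<Oplus>\<^bsub>V\<^esub>i\<in>I. c i \<odot>\<^bsub>V\<^esub> w i) = N"
      using that(2) unfolding sum[OF that(1)] zero .
    then show ?thesis
      using indep[OF that(1)] a_coset_join1[OF _ closed[OF that(1)] N.a_subgroup] by blast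
  qed
  have gen': "\<exists>c\<in>I \<rightarrow> carrier K.
      C = (\<Oplus>\<^bsub>quotient_module V N\<^esub>i\<in>I. c i \<odot>\<^bsub>quotient_module V N\<^esub> (N +>\<^bsub>V\<^esub> w i))"
    if "C \<in> carrier (quotient_module V N)" for C
  proof -
    from that obtain v where v: "v \<in> carrier V" "C = N +>\<^bsub>V\<^esub> v"
      unfolding quotient_module_def A_RCOSETS_def' by auto
    from gen[OF v(1)] obtain c h where c: "c \<in> I \<rightarrow> carrier K" "h \<in> N"
      "v = h \<oplus>\<^bsub>V\<^esub> (\<Oplus>\<^bsub>V\<^esub>i\<in>I. c i \<odot>\<^bsub>V\<^esub> w i)" by blast
    have "v \<in> N +>\<^bsub>V\<^esub> (\<Oplus>\<^bsub>V\<^esub>i\<in>I. c i \<odot>\<^bsub>V\<^esub> w i)"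
      unfolding a_r_coset_def' using c(2,3) by blast
    then have "C = N +>\<^bsub>V\<^esub> (\<Oplus>\<^bsub>V\<^esub>i\<in>I. c i \<odot>\<^bsub>V\<^esub> w i)"
      using v(2) a_repr_independence[OF _ closed[OF c(1)] N.a_subgroup] by blast
    then show ?thesis using c(1) by (intro bexI[OF _ c(1)]) (simp only: sum)
  qed
  show "inj_on (\<lambda>i. N +>\<^bsub>V\<^esub> w i) I"
    using W.indexed_basisI(1)[OF I w' indep' gen'] .
  show "vectorspace.basis K (quotient_module V N) ((\<lambda>i. N +>\<^bsub>V\<^esub> w i) ` I)"
    using W.indexed_basisI(2)[OF I w' indep' gen'] .
qed

end

section \<open>Cocycles and right multiplication by a generator\<close>

declare One_nat_def [simp del]

sublocale null_filiform \<subseteq> leibniz_superalgebra scale grading br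
  by (rule is_leibniz_superalgebra)

context leibniz_superalgebra
begin

text \<open>The sign depends only on the degrees of \<open>v\<close> and \<open>w\<close>, so the
  identity is additive in \<open>u\<close> and extends from homogeneous \<open>u\<close> to all
  \<open>u\<close>. The same holds for \<open>cocycle2_left\<close>.\<close>

lemma leibniz_left:
  assumes "v \<in> V b" "w \<in> V c"
  shows "br u (br v w) = br (br u v) w - koszul b c (br (br u w) v)"
proof -
  obtain u0 u1 where u: "u0 \<in> V 0" "u1 \<in> V 1" "u = u0 + u1"
    using V_sum by blast
  then show ?thesis
    using leibniz[OF u(1) assms] leibniz[OF u(2) assms] by (simp add: br_lin koszul_linear)
qed

lemma cocycle2_left:
  assumes \<phi>: "is_even_cocycle2 scale V br \<phi>" and v: "v \<in> V b" and w: "w \<in> V c"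
  shows "br u (\<phi> v w) - br (\<phi> u v) w + koszul b c (br (\<phi> u w) v)
      + \<phi> u (br v w) - \<phi> (br u v) w + koszul b c (\<phi> (br u w) v) = 0"
proof -
  let ?c = "\<lambda>u. br u (\<phi> v w) - br (\<phi> u v) w + koszul b c (br (\<phi> u w) v)
      + \<phi> u (br v w) - \<phi> (br u v) w + koszul b c (\<phi> (br u w) v)"
  have bil: "bilinear_over scale \<phi>"
    using \<phi> by (simp add: is_even_cocycle2_def even_bilinear_def)
  have c0: "?c u = 0" if "u \<in> V a" for u a
    using \<phi> that v w unfolding is_even_cocycle2_def by blast
  obtain u0 u1 where u: "u0 \<in> V 0" "u1 \<in> V 1" "u = u0 + u1"
    using V_sum by blast
  have "?c (u0 + u1) = ?c u0 + ?c u1"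
    by (simp add: br_lin bilinear_over_left[OF bil] koszul_linear)
  also have "\<dots> = 0" by (simp only: c0[OF u(1)] c0[OF u(2)] add_0)
  finally show ?thesis unfolding u(3) .
qed

end

section \<open>The chain generated from \<open>y 1\<close> by right multiplication\<close>

context null_filiform
begin

definition R :: "'v \<Rightarrow> 'v" where
  "R u = br u (y 1)"

definition e :: "nat \<Rightarrow> 'v" where
  "e m = (R ^^ m) (y 1)"

lemma R_lin: "R (u + v) = R u + R v" "R (u - v) = R u - R v" "R (- u) = - R u" "R 0 = 0"
  "R (scale c u) = scale c (R u)"
  by (simp_all add: R_def br_lin)

lemma R_funpow_lin: "(R ^^ m) (u + v) = (R ^^ m) u + (R ^^ m) v"
  "(R ^^ m) (scale c u) = scale c ((R ^^ m) u)" "(R ^^ m) 0 = 0"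
  by (induction m) (simp_all add: R_lin)

lemma e_0: "e 0 = y 1" and e_1: "e 1 = R (y 1)" and e_Suc: "e (Suc m) = R (e m)"
  by (simp_all add: e_def One_nat_def)

text \<open>The chain alternates between the two families; each passage from \<open>x i\<close> to
  \<open>y (i + 1)\<close> contributes a factor 1/2.\<close>

lemma e_odd_even:
  assumes "i < n"
  shows "e (2 * i) = scale ((1/2) ^ i) (y (i + 1))"
    and "e (2 * i + 1) = scale ((1/2) ^ i) (x (i + 1))"
proof -
  have "e (2 * i) = scale ((1/2) ^ i) (y (i + 1)) \<and>
      e (2 * i + 1) = scale ((1/2) ^ i) (x (i + 1))"
    using assms
  proof (induction i)
    case 0
    then show ?case by (simp add: e_0 e_1 R_def br_y_y)
  next
    case (Suc i)
    then show ?case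
      by (simp add: e_Suc R_lin) (simp add: R_def br_x_y br_y_y br_lin mult_ac One_nat_def)
  qed
  then show "e (2 * i) = scale ((1/2) ^ i) (y (i + 1))"
    and "e (2 * i + 1) = scale ((1/2) ^ i) (x (i + 1))" by auto
qed

lemma y_eq_e: "i \<in> {1..n} \<Longrightarrow> y i = scale (2 ^ (i - 1)) (e (2 * (i - 1)))"
  and x_eq_e: "i \<in> {1..n} \<Longrightarrow> x i = scale (2 ^ (i - 1)) (e (2 * (i - 1) + 1))"
proof -
  have 1: "(2::'a) ^ m * (1/2) ^ m = 1" for m
    by (simp flip: power_mult_distrib)
  assume "i \<in> {1..n}"
  then have "i - 1 < n" "i - 1 + 1 = i" by auto
  then show "y i = scale (2 ^ (i - 1)) (e (2 * (i - 1)))"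
    and "x i = scale (2 ^ (i - 1)) (e (2 * (i - 1) + 1))"
    by (simp_all add: e_odd_even 1)
qed

text \<open>The chain reaches a multiple of \<open>x n\<close> at index \<open>2 * n - 1\<close>,
  and \<open>R\<close> annihilates \<open>x n\<close>.\<close>

lemma e_eq_0:
  assumes "m \<ge> 2 * n" "n \<ge> 1"
  shows "e m = 0"
  using assms(1)
proof (induction m rule: dec_induct)
  case base
  have "e (2 * n) = R (e (2 * (n - 1) + 1))"
    unfolding e_Suc[symmetric] using assms(2) by (intro arg_cong[where f = e]) simp
  also have "\<dots> = 0"
    using assms(2) by (simp add: e_odd_even R_lin) (simp add: R_def br_x_y)
  finally show ?case .
qed (simp add: e_Suc R_lin)

text \<open>Every basis vector is a scalar multiple of some \<open>e m\<close> with
  \<open>m < 2 * n\<close>, so these vectors span.\<close>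

lemma linear_zero_on_e:
  assumes f: "Vector_Spaces.linear scale scale f" and e: "\<And>m. m < 2 * n \<Longrightarrow> f (e m) = 0"
  shows "f u = 0"
proof -
  interpret f: Vector_Spaces.linear scale scale f by (rule f)
  have "f b = 0" if "b \<in> basis_vectors" for b
    using that
  proof
    assume "b \<in> x ` {1..n}"
    then obtain i where i: "i \<in> {1..n}" "b = x i" by blast
    then have "2 * (i - 1) + 1 < 2 * n" by auto
    then show ?thesis unfolding i(2) x_eq_e[OF i(1)] f.scale by (simp only: e scale_zero_right)
  next
    assume "b \<in> y ` {1..n}"
    then obtain i where i: "i \<in> {1..n}" "b = y i" by blast
    then have "2 * (i - 1) < 2 * n" by auto
    then show ?thesis unfolding i(2) y_eq_e[OF i(1)] f.scale by (simp only: e scale_zero_right)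
  qed
  moreover have "u \<in> span basis_vectors" unfolding span_basis by (rule UNIV_I)
  ultimately show ?thesis
    by (metis f.eq_0_on_span)
qed

text \<open>The degree of \<open>e m\<close>. Even indices are odd vectors because the chain starts
  at the odd vector \<open>y 1\<close> and \<open>R\<close> switches degree.\<close>

definition parity :: "nat \<Rightarrow> bit" where
  "parity m = (if even m then 1 else 0)"

lemma grading_y1: "n \<ge> 1 \<Longrightarrow> y 1 \<in> grading 1"
  by (auto simp: grading_def intro!: span_base)

lemma e_in_grading:
  assumes "n \<ge> 1"
  shows "e m \<in> grading (parity m)"
proof (induction m)
  case 0
  show ?case using grading_y1[OF assms] by (simp add: e_0 parity_def)
next
  case (Suc m)
  have "R (e m) \<in> grading (parity m + 1)"
    unfolding R_def using br_even Suc grading_y1[OF assms] unfolding even_bilinear_def by blast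
  then show ?case by (simp add: e_Suc parity_def split: if_splits)
qed

lemma br_e1:
  assumes "n \<ge> 1"
  shows "br u (e 1) = scale 2 (R (R u))"
proof -
  have "br u (e 1) = R (R u) + R (R u)"
    using leibniz_left[OF grading_y1 grading_y1, of u] assms
    by (simp add: e_1 R_def koszul_def)
  then show ?thesis by (metis one_add_one scale_left_distrib scale_one)
qed

text \<open>Since \<open>e 1\<close> is an even vector, the Leibniz identity for
  \<open>e 2 = R (e 1)\<close> is a difference without sign change, and its two terms both equal
  twice the third power of \<open>R\<close> at \<open>u\<close>. From there on every term of the
  recursion is zero.\<close>

lemma br_e:
  assumes "n \<ge> 1" "m \<ge> 2"
  shows "br u (e m) = 0"
proof -
  have rec: "br u (e (Suc m)) = R (br u (e m)) - koszul (parity m) 1 (br (R u) (e m))" for u m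
    using leibniz_left[OF e_in_grading grading_y1, of u] assms by (simp add: e_Suc R_def)
  show ?thesis using assms(2)
  proof (induction m arbitrary: u rule: dec_induct)
    case base
    show ?case
      using rec[of u 1] br_e1 assms by (simp add: numeral_2_eq_2 One_nat_def parity_def koszul_def R_lin)
  qed (simp add: rec R_lin koszul_linear)
qed

text \<open>For \<open>k\<close> at least 2, \<open>y k\<close> is a multiple of
  \<open>e (2 * (k - 1))\<close>, whose right action vanishes by \<open>br_e\<close>. Only the
  \<open>y 1\<close> component acts.\<close>

lemma odd_decomposition:
  assumes "n \<ge> 1" "v \<in> grading 1"
  obtains b where "v = (\<Sum>k\<in>{1..n}. scale (b k) (y k))" "\<And>u. br u v = scale (b 1) (R u)"
proof -
  have "v \<in> span (y ` {1..n})" using assms by (simp add: grading_def)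
  then obtain c where "v = (\<Sum>w\<in>y ` {1..n}. scale (c w) w)"
    by (auto simp: span_finite)
  then have v: "v = (\<Sum>k\<in>{1..n}. scale (c (y k)) (y k))"
    using sum.reindex[OF inj_y, of "\<lambda>w. scale (c w) w"] by simp
  have br_sum: "br u (sum g A) = (\<Sum>k\<in>A. br u (g k))" for u A and g :: "nat \<Rightarrow> 'v"
    by (induction A rule: infinite_finite_induct) (simp_all add: br_lin)
  have br_y: "br u (y k) = 0" if "k \<in> {2..n}" for u k
  proof -
    have "k \<in> {1..n}" using that by auto
    then show ?thesis
      using br_e[OF assms(1), of "2 * (k - 1)" u] that by (subst y_eq_e) (auto simp: br_lin)
  qed
  have "br u v = scale (c (y 1)) (R u)" for u
  proof -
    have "{1..n} = insert 1 {2..n}" using assms(1) by auto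
    then show ?thesis unfolding v by (simp add: br_lin br_sum br_y R_def)
  qed
  with v show thesis by (intro that[of "\<lambda>k. c (y k)"]) auto
qed

section \<open>Recursion for a cocycle in its second argument\<close>

lemma cocycle_e_Suc:
  assumes "n \<ge> 1" and \<phi>: "is_even_cocycle2 scale grading br \<phi>"
  shows "\<phi> u (e (Suc m)) = R (\<phi> u (e m)) + \<phi> (br u (e m)) (y 1) - br u (\<phi> (e m) (y 1))
    - koszul (parity m) 1 (br (\<phi> u (y 1)) (e m) + \<phi> (R u) (e m))"
  using cocycle2_left[OF \<phi> e_in_grading[OF assms(1)] grading_y1[OF assms(1)], of u m]
  by (simp add: e_Suc R_def koszul_linear algebra_simps)

lemma cocycle_bilinear:
  assumes "is_even_cocycle2 scale grading br \<phi>"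
  shows "bilinear_over scale \<phi>"
  using assms by (simp add: is_even_cocycle2_def even_bilinear_def)

text \<open>Case \<open>m = 0\<close> of the recursion. Both \<open>e 0\<close> and
  \<open>y 1\<close> are odd, so the Koszul sign makes the terms add up instead of
  cancelling.\<close>

lemma cocycle_e_1:
  assumes "n \<ge> 1" and \<phi>: "is_even_cocycle2 scale grading br \<phi>"
  shows "\<phi> u (e 1) = scale 2 (R (\<phi> u (y 1)) + \<phi> (R u) (y 1)) - br u (\<phi> (y 1) (y 1))"
proof -
  have "scale 2 w = w + w" for w
    by (metis one_add_one scale_left_distrib scale_one)
  then show ?thesis
    using cocycle_e_Suc[OF assms, of u 0]
    by (simp add: e_0 R_def parity_def koszul_def algebra_simps flip: One_nat_def)
qed

text \<open>For \<open>m = 0\<close>, substituting \<open>cocycle_e_1\<close> cancels everything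
  except the bracket with \<open>\<phi> (e 1) (y 1)\<close>. Later on, the preceding value
  \<open>\<phi> _ (e (Suc m))\<close> and the right action of \<open>e (Suc m)\<close> are both
  zero, which again leaves one bracket.\<close>

lemma cocycle_e_Suc_Suc:
  assumes "n \<ge> 1" and \<phi>: "is_even_cocycle2 scale grading br \<phi>"
    and "\<And>j. j \<le> m \<Longrightarrow> \<phi> (e j) (y 1) = 0"
  shows "\<phi> u (e (Suc (Suc m))) = - br u (\<phi> (e (Suc m)) (y 1))"
  using assms(3)
proof (induction m arbitrary: u)
  case 0
  note lin = bilinear_over_left[OF cocycle_bilinear[OF \<phi>]]
    bilinear_over_right[OF cocycle_bilinear[OF \<phi>]]
  have "\<phi> (y 1) (y 1) = 0" using 0[of 0] by (simp add: e_0)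
  then show ?case
    using cocycle_e_Suc[OF assms(1,2), of u 1] cocycle_e_1[OF assms(1,2)]
    by (simp add: br_e1[OF assms(1)] parity_def koszul_def lin R_lin br_lin scale_right_distrib
        algebra_simps flip: One_nat_def numeral_2_eq_2)
next
  case (Suc m)
  note lin = bilinear_over_left[OF cocycle_bilinear[OF \<phi>]]
  have "\<phi> u (e (Suc (Suc m))) = 0" for u
    using Suc by (simp add: br_lin)
  then show ?case
    using cocycle_e_Suc[OF assms(1,2), of u "Suc (Suc m)"]
    by (simp add: br_e[OF assms(1)] lin R_lin koszul_linear)
qed

text \<open>Because \<open>e (2 * n) = 0\<close>, the value of \<open>\<phi>\<close> there is zero,
  while the recursion expresses it by the bracket in question. This is the only constraint on the
  end value used later.\<close>

lemma cocycle_last_value: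
  assumes "n \<ge> 1" and \<phi>: "is_even_cocycle2 scale grading br \<phi>"
    and "\<And>j. j < 2 * n - 1 \<Longrightarrow> \<phi> (e j) (y 1) = 0"
  shows "br u (\<phi> (e (2 * n - 1)) (y 1)) = 0"
proof -
  have n: "Suc (Suc (2 * n - 2)) = 2 * n" "Suc (2 * n - 2) = 2 * n - 1" using assms(1) by auto
  have "\<phi> u (e (2 * n)) = - br u (\<phi> (e (2 * n - 1)) (y 1))"
    using cocycle_e_Suc_Suc[OF assms(1,2), of "2 * n - 2" u] assms(1,3) unfolding n by simp
  then show ?thesis
    using e_eq_0[of "2 * n"] assms(1) bilinear_over_right(4)[OF cocycle_bilinear[OF \<phi>]] by simp
qed

text \<open>Injectivity of restricting a cocycle to second argument \<open>y 1\<close>: the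
  recursion recovers all remaining values.\<close>

lemma cocycle_eq_0:
  assumes "n \<ge> 1" and \<phi>: "is_even_cocycle2 scale grading br \<phi>"
    and e: "\<And>j. j < 2 * n \<Longrightarrow> \<phi> (e j) (y 1) = 0"
  shows "\<phi> u v = 0"
proof -
  note bil = cocycle_bilinear[OF \<phi>]
  have lin: "Vector_Spaces.linear scale scale (\<lambda>u. \<phi> u (y 1))"
    "Vector_Spaces.linear scale scale (\<phi> u)" for u
    using bil by (auto simp: bilinear_over_def)
  have y1: "\<phi> u (y 1) = 0" for u
    by (rule linear_zero_on_e[OF lin(1) e])
  have "\<phi> u (e m) = 0" for m
  proof -
    consider "m = 0" | "m = 1" | j where "m = Suc (Suc j)" by (metis One_nat_def nat.exhaust)
    then show ?thesis
      using cocycle_e_1[OF assms(1,2), of u] cocycle_e_Suc_Suc[OF assms(1,2)]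
      by cases (simp_all add: y1 e_0 R_lin br_lin)
  qed
  then show ?thesis by (rule linear_zero_on_e[OF lin(2)])
qed

end

section \<open>The cocycles \<open>psi k\<close>\<close>

context leibniz_superalgebra
begin

text \<open>For fixed degrees \<open>b\<close> and \<open>c\<close> the identity is trilinear, so
  its zero set in each argument is a subspace and span induction applies three times.\<close>

lemma cocycle2I_span:
  assumes \<phi>: "even_bilinear scale V \<phi>" and V: "\<And>a. V a = span (B a)"
    and basis: "\<And>a b c u v w. u \<in> B a \<Longrightarrow> v \<in> B b \<Longrightarrow> w \<in> B c \<Longrightarrow>
      br u (\<phi> v w) - br (\<phi> u v) w + koszul b c (br (\<phi> u w) v)
      + \<phi> u (br v w) - \<phi> (br u v) w + koszul b c (\<phi> (br u w) v) = 0"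
  shows "is_even_cocycle2 scale V br \<phi>"
proof -
  define D where "D b c u v w = br u (\<phi> v w) - br (\<phi> u v) w + koszul b c (br (\<phi> u w) v)
      + \<phi> u (br v w) - \<phi> (br u v) w + koszul b c (\<phi> (br u w) v)" for b c u v w
  have bil: "bilinear_over scale \<phi>"
    using \<phi> by (simp add: even_bilinear_def)
  note lin = br_lin bilinear_over_left[OF bil] bilinear_over_right[OF bil] koszul_linear
  have add: "D b c (u + u') v w = D b c u v w + D b c u' v w"
    "D b c u (v + v') w = D b c u v w + D b c u v' w"
    "D b c u v (w + w') = D b c u v w + D b c u v w'" for b c u u' v v' w w'
    by (simp_all add: D_def lin)
  have scale: "D b c (scale r u) v w = scale r (D b c u v w)"
    "D b c u (scale r v) w = scale r (D b c u v w)"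
    "D b c u v (scale r w) = scale r (D b c u v w)" for b c u v w r
    by (simp_all add: D_def lin scale_right_distrib scale_right_diff_distrib)
  have zero: "D b c 0 v w = 0" "D b c u 0 w = 0" "D b c u v 0 = 0" for b c u v w
    by (simp_all add: D_def lin)
  have subspaces: "subspace {u. D b c u v w = 0}" "subspace {v. D b c u v w = 0}"
    "subspace {w. D b c u v w = 0}" for b c u v w
    by (rule subspaceI; simp add: add scale zero)+
  have "D b c u v w = 0" if u: "u \<in> V a" and v: "v \<in> V b" and w: "w \<in> V c" for a b c u v w
  proof -
    have w': "D b c u v w = 0" if "u \<in> B a" "v \<in> B b" for u v
      by (rule span_induct[OF w[unfolded V] subspaces(3)]) (use basis that in \<open>simp add: D_def\<close>)
    have v': "D b c u v w = 0" if "u \<in> B a" for u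
      by (rule span_induct[OF v[unfolded V] subspaces(2)]) (use w' that in blast)
    show ?thesis
      by (rule span_induct[OF u[unfolded V] subspaces(1)]) (use v' in blast)
  qed
  then show ?thesis
    using \<phi> by (simp add: is_even_cocycle2_def D_def)
qed

lemma even_bilinearI_span:
  assumes bil: "bilinear_over scale \<phi>" and V: "\<And>a. V a = span (B a)"
    and basis: "\<And>a b u v. u \<in> B a \<Longrightarrow> v \<in> B b \<Longrightarrow> \<phi> u v \<in> V (a + b)"
  shows "even_bilinear scale V \<phi>"
proof -
  note lin = bilinear_over_left[OF bil] bilinear_over_right[OF bil]
  have subspaces: "subspace {u. \<phi> u v \<in> V a}" "subspace {v. \<phi> u v \<in> V a}" for a u v
    by (rule subspaceI; simp add: lin V_closed)+
  have "\<phi> u v \<in> V (a + b)" if u: "u \<in> V a" and v: "v \<in> V b" for a b u v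
  proof -
    have v': "\<phi> u v \<in> V (a + b)" if "u \<in> B a" for u
      by (rule span_induct[OF v[unfolded V] subspaces(2)]) (use basis that in blast)
    show ?thesis
      by (rule span_induct[OF u[unfolded V] subspaces(1)]) (use v' in blast)
  qed
  then show ?thesis
    using bil by (simp add: even_bilinear_def)
qed

end

context null_filiform
begin

text \<open>A finite check on basis triples. The factors 2 in \<open>psi\<close> are forced by
  \<open>cocycle_e_1\<close>: the value \<open>y k\<close> at \<open>(x n, y 1)\<close> yields
  \<open>2 [y k, y 1] = 2 x k\<close> at \<open>(x n, x 1)\<close> and \<open>2 y k\<close> at
  \<open>(y n, x 1)\<close>.\<close>

lemma psi_cocycle2:
  assumes k: "k \<in> {2..n}"
  shows "is_even_cocycle2 scale grading br (psi k)"
proof -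
  define E where "E a = (if a = 0 then x else y)" for a :: bit
  have E01: "E 0 = x" "E 1 = y" by (simp_all add: E_def)
  have gr: "grading a = span (E a ` {1..n})" for a by (simp add: grading_def E_def)
  \<comment> \<open>As \<open>k\<close> differs from 1, right multiplication by \<open>x k\<close>
    and \<open>y k\<close> is zero, which kills the first term of the identity.\<close>
  have k1: "k \<in> {1..n}" "1 \<in> {1..n}" "2 \<in> {1..n}" "n \<in> {1..n}" "k \<noteq> 1" "n \<noteq> 1" using k by auto
  note lin = br_lin bilinear_over_left[OF psi_bilinear] bilinear_over_right[OF psi_bilinear]
  have in_gr: "x k \<in> grading 0" "y k \<in> grading 1"
    using k1(1) unfolding gr E01 by (auto intro: span_base)
  have even: "even_bilinear scale grading (psi k)"
  proof (rule even_bilinearI_span[OF psi_bilinear gr])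
    fix a b u v assume "u \<in> E a ` {1..n}" "v \<in> E b ` {1..n}"
    then obtain i j where "i \<in> {1..n}" "j \<in> {1..n}" "u = E a i" "v = E b j" by blast
    then show "psi k u v \<in> grading (a + b)"
      using in_gr by (cases a; cases b)
        (simp_all add: E01 psi_basis V_closed del: atLeastAtMost_iff)
  qed
  show ?thesis
  proof (rule cocycle2I_span[OF even gr])
    fix a b c u v w assume "u \<in> E a ` {1..n}" "v \<in> E b ` {1..n}" "w \<in> E c ` {1..n}"
    then obtain i j l where ijl: "i \<in> {1..n}" "j \<in> {1..n}" "l \<in> {1..n}"
      and uvw: "u = E a i" "v = E b j" "w = E c l" by blast
    have 1: "m + 1 \<in> {1..n}" if "m < n" for m using that by simp
    \<comment> \<open>Splitting doubles into sums and then merging two halves cancels the 1/2 of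
      \<open>[x i, y 1]\<close> against the 2 in \<open>psi\<close>.\<close>
    have 2: "scale 2 u = u + u" for u
      by (metis one_add_one scale_left_distrib scale_one)
    have 3: "scale (1/2) u + scale (1/2) u = u" for u
      by (simp flip: scale_left_distrib)
    have "m + 1 = 1 \<longleftrightarrow> m = 0" for m :: nat by simp
    moreover have "i \<noteq> 0" "j \<noteq> 0" "l \<noteq> 0" "m + 1 = n \<Longrightarrow> m < n" for m using ijl by auto
    ultimately show "br u (psi k v w) - br (psi k u v) w + koszul b c (br (psi k u w) v)
      + psi k u (br v w) - psi k (br u v) w + koszul b c (psi k (br u w) v) = 0"
      unfolding uvw by (cases a; cases b; cases c)
        (auto simp: E01 br_x_x br_x_y br_y_x br_y_y psi_basis lin ijl k1 1 2 3 scale_right_distrib koszul_def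
          simp del: atLeastAtMost_iff)
  qed
qed

end

section \<open>Cocycles modulo coboundaries\<close>

context leibniz_superalgebra
begin

lemma cocycle2_sum:
  assumes "\<And>i. i \<in> I \<Longrightarrow> is_even_cocycle2 scale V br (w i)"
  shows "is_even_cocycle2 scale V br (\<lambda>u v. \<Sum>i\<in>I. w i u v)"
  using assms
proof (induction I rule: infinite_finite_induct)
  case (insert i I)
  then have "is_even_cocycle2 scale V br (\<lambda>u v. w i u v + (\<Sum>i\<in>I. w i u v))"
    by (intro cocycle2_add) auto
  then show ?case using insert by simp
qed (simp_all add: cocycle2_0)

lemma cocycle2_diff:
  assumes "is_even_cocycle2 scale V br \<phi>" "is_even_cocycle2 scale V br \<psi>"
  shows "is_even_cocycle2 scale V br (\<lambda>u v. \<phi> u v - \<psi> u v)"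
  using cocycle2_add[OF assms(1) cocycle2_scale[OF assms(2), of "- 1"]] by simp

text \<open>Turns sums in the module of cocycles into pointwise sums, the form in which cocycles are
  computed.\<close>

lemma finsum_ZL2_even:
  assumes "finite I" "w \<in> I \<rightarrow> carrier (ZL2_even scale V br)"
  shows "(\<Oplus>\<^bsub>ZL2_even scale V br\<^esub>i\<in>I. c i \<odot>\<^bsub>ZL2_even scale V br\<^esub> w i)
    = (\<lambda>u v. \<Sum>i\<in>I. scale (c i) (w i u v))"
proof -
  interpret Z: vectorspace class_ring "ZL2_even scale V br"
    by (rule vectorspace_ZL2_even)
  show ?thesis
    using assms
  proof (induction I rule: finite_induct)
    case empty
    show ?case by (simp only: Z.M.finsum_empty sum.empty) (simp add: ZL2_even_def)
  next
    case (insert i I)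
    have "c j \<odot>\<^bsub>ZL2_even scale V br\<^esub> w j \<in> carrier (ZL2_even scale V br)" if "j \<in> insert i I" for j
      using insert.prems that by (intro Z.smult_closed) auto
    then have "(\<Oplus>\<^bsub>ZL2_even scale V br\<^esub>j\<in>insert i I. c j \<odot>\<^bsub>ZL2_even scale V br\<^esub> w j)
      = c i \<odot>\<^bsub>ZL2_even scale V br\<^esub> w i \<oplus>\<^bsub>ZL2_even scale V br\<^esub>
        (\<Oplus>\<^bsub>ZL2_even scale V br\<^esub>j\<in>I. c j \<odot>\<^bsub>ZL2_even scale V br\<^esub> w j)"
      using insert.hyps by (intro Z.M.finsum_insert) auto
    then show ?case
      using insert by (simp add: ZL2_even_def fun_eq_iff)
  qed
qed

end

section \<open>Splitting a cocycle into a coboundary and a combination of the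
  \<open>psi k\<close>\<close>

context null_filiform
begin

text \<open>Restricted to second argument \<open>y 1\<close>, \<open>psi k\<close> sees only the
  last chain vector \<open>e (2 * n - 1)\<close>, which is \<open>(1/2) ^ (n - 1)\<close> times
  \<open>x n\<close>.\<close>

lemma psi_e_y1:
  assumes "k \<in> {1..n}" "m < 2 * n"
  shows "psi k (e m) (y 1) = (if m = 2 * n - 1 then scale ((1/2) ^ (n - 1)) (y k) else 0)"
proof -
  note lin = bilinear_over_left[OF psi_bilinear]
  have 1: "1 \<in> {1..n}" using assms by auto
  show ?thesis
  proof (cases "even m")
    case True
    then obtain i where i: "m = 2 * i" by blast
    then have "i < n" "i + 1 \<in> {1..n}" "m \<noteq> 2 * n - 1" using assms by auto
    then show ?thesis
      unfolding i using 1 by (simp add: e_odd_even lin psi_basis del: atLeastAtMost_iff)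
  next
    case False
    then obtain i where i: "m = 2 * i + 1" using oddE by blast
    then have "i < n" "i + 1 \<in> {1..n}" "i + 1 = n \<longleftrightarrow> m = 2 * n - 1" "i + 1 = n \<Longrightarrow> i = n - 1"
      using assms by auto
    then show ?thesis
      unfolding i using 1 by (simp add: e_odd_even lin psi_basis del: atLeastAtMost_iff)
  qed
qed

lemma even_linear_extension:
  assumes n: "n \<ge> 1" and G: "\<And>m. G m \<in> grading (parity m)"
  obtains f where "even_linear scale grading f" "\<And>m. m < 2 * n \<Longrightarrow> f (e m) = G m"
proof -
  \<comment> \<open>The powers of two come from writing \<open>y i\<close> and \<open>x i\<close> as
    multiples of chain vectors.\<close>
  define f where "f u = (\<Sum>i\<in>{1..n}. scale (coord u (y i) * 2 ^ (i - 1)) (G (2 * (i - 1)))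
      + scale (coord u (x i) * 2 ^ (i - 1)) (G (2 * (i - 1) + 1)))" for u
  have lin: "Vector_Spaces.linear scale scale f"
    by (rule linear_overI)
      (simp_all add: f_def coord_add coord_scale distrib_right scale_left_distrib sum.distrib
        scale_sum_right scale_right_distrib distrib_left mult_ac add_ac)
  interpret f: Vector_Spaces.linear scale scale f by (rule lin)
  have xy: "f (y i) = scale (2 ^ (i - 1)) (G (2 * (i - 1)))"
    "f (x i) = scale (2 ^ (i - 1)) (G (2 * (i - 1) + 1))" if i: "i \<in> {1..n}" for i
  proof -
    have "f (y i) = (\<Sum>j\<in>{1..n}. if j = i then scale (2 ^ (j - 1)) (G (2 * (j - 1))) else 0)"
      unfolding f_def using i
      by (intro sum.cong refl) (simp add: coord_basis x_in y_in y_eq_iff x_neq_y del: atLeastAtMost_iff Un_iff)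
    then show "f (y i) = scale (2 ^ (i - 1)) (G (2 * (i - 1)))"
      using i by simp
    have "f (x i) = (\<Sum>j\<in>{1..n}. if j = i then scale (2 ^ (j - 1)) (G (2 * (j - 1) + 1)) else 0)"
      unfolding f_def using i
      by (intro sum.cong refl)
        (simp add: coord_basis x_in y_in x_eq_iff x_neq_y[symmetric] del: atLeastAtMost_iff Un_iff)
    then show "f (x i) = scale (2 ^ (i - 1)) (G (2 * (i - 1) + 1))"
      using i by simp
  qed
  have 1: "(1/2) ^ i * 2 ^ i = (1::'a)" for i
    by (simp flip: power_mult_distrib)
  have e: "f (e m) = G m" if "m < 2 * n" for m
  proof (cases "even m")
    case True
    then obtain i where i: "m = 2 * i" by blast
    then have "i < n" "i + 1 \<in> {1..n}" using that by auto
    then show ?thesis unfolding i by (simp add: e_odd_even f.scale xy 1 del: atLeastAtMost_iff)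
  next
    case False
    then obtain i where i: "m = 2 * i + 1" using oddE by blast
    then have "i < n" "i + 1 \<in> {1..n}" using that by auto
    then show ?thesis unfolding i by (simp add: e_odd_even f.scale xy 1 del: atLeastAtMost_iff)
  qed
  have "f u \<in> grading a" if "u \<in> grading a" for a u
  proof -
    have Gr: "G (2 * m) \<in> grading 1" "G (2 * m + 1) \<in> grading 0" for m
      using G[of "2 * m"] G[of "2 * m + 1"] by (simp_all add: parity_def)
    have "f b \<in> grading a" if b: "b \<in> (if a = 0 then x else y) ` {1..n}" for b
    proof (cases a)
      case zero
      then obtain i where "i \<in> {1..n}" "b = x i" using b by auto
      then show ?thesis using Gr(2)[of "i - 1"] zero by (simp add: xy V_closed)
    next
      case one
      then obtain i where "i \<in> {1..n}" "b = y i" using b by auto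
      then show ?thesis using Gr(1)[of "i - 1"] one by (simp add: xy V_closed)
    qed
    moreover have "subspace {u. f u \<in> grading a}"
      by (rule subspaceI) (simp_all add: f.add f.scale V_closed)
    ultimately show ?thesis
      using span_induct[OF that[unfolded grading_def], of "\<lambda>u. f u \<in> grading a"] by blast
  qed
  then have "even_linear scale grading f" using lin by (simp add: even_linear_def)
  then show thesis using e by (rule that)
qed

lemma cocycle_decomposition:
  assumes n: "n \<ge> 1" and \<phi>: "is_even_cocycle2 scale grading br \<phi>"
  obtains f c where "even_linear scale grading f"
    "\<phi> = (\<lambda>u v. d1 br f u v + (\<Sum>k\<in>{2..n}. scale (c k) (psi k u v)))"
proof -
  have even: "\<psi> u v \<in> grading (a + b)"
    if "is_even_cocycle2 scale grading br \<psi>" "u \<in> grading a" "v \<in> grading b" for \<psi> u v a b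
    using that unfolding is_even_cocycle2_def even_bilinear_def by blast
  have parity_Suc: "parity (Suc m) = parity m + 1" for m
    by (simp add: parity_def)
  \<comment> \<open>With \<open>f (y 1) = 0\<close>, the equation
    \<open>d1 br f (e m) (y 1) = \<phi> (e m) (y 1)\<close> reads
    \<open>f (e (Suc m)) = R (f (e m)) - \<phi> (e m) (y 1)\<close>; \<open>G\<close> solves it from
    \<open>f (e 0) = 0\<close>.\<close>
  define G where "G = rec_nat 0 (\<lambda>m g. R g - \<phi> (e m) (y 1))"
  have G0: "G 0 = 0" and G_Suc: "G (Suc m) = R (G m) - \<phi> (e m) (y 1)" for m
    by (simp_all add: G_def)
  have "G m \<in> grading (parity m)" for m
  proof (induction m)
    case (Suc m)
    have "R (G m) \<in> grading (parity m + 1)"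
      unfolding R_def using br_even Suc grading_y1[OF n] unfolding even_bilinear_def by blast
    moreover have "\<phi> (e m) (y 1) \<in> grading (parity m + 1)"
      by (rule even[OF \<phi> e_in_grading[OF n] grading_y1[OF n]])
    ultimately show ?case by (simp add: G_Suc parity_Suc V_closed)
  qed (simp add: G0 V_closed)
  then obtain f where f: "even_linear scale grading f" "\<And>m. m < 2 * n \<Longrightarrow> f (e m) = G m"
    using even_linear_extension[OF n] by blast
  interpret f: Vector_Spaces.linear scale scale f using f(1) by (simp add: even_linear_def)
  define \<phi>' where "\<phi>' u v = \<phi> u v - d1 br f u v" for u v
  have \<phi>': "is_even_cocycle2 scale grading br \<phi>'"
    using cocycle2_diff[OF \<phi> d1_cocycle2[OF f(1)]] by (simp add: \<phi>'_def[abs_def])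
  have fy1: "f (y 1) = 0" using f(2)[of 0] n by (simp add: e_0 G0)
  \<comment> \<open>The last index is excluded: there \<open>e (Suc m) = 0\<close>, so
    \<open>f (e (Suc m))\<close> can no longer be prescribed.\<close>
  have \<phi>'_e: "\<phi>' (e m) (y 1) = 0" if "m < 2 * n - 1" for m
  proof -
    have "d1 br f (e m) (y 1) = R (G m) - G (Suc m)"
      using f(2)[of m] f(2)[of "Suc m"] that by (simp add: d1_def fy1 br_lin e_Suc flip: R_def)
    then show ?thesis by (simp add: \<phi>'_def G_Suc)
  qed
  have "parity (2 * n - 1) + 1 = 1"
    using n by (simp add: parity_def)
  then have "\<phi>' (e (2 * n - 1)) (y 1) \<in> grading 1"
    using even[OF \<phi>' e_in_grading[OF n] grading_y1[OF n], of "2 * n - 1"] by simp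
  then obtain b where b: "\<phi>' (e (2 * n - 1)) (y 1) = (\<Sum>k\<in>{1..n}. scale (b k) (y k))"
    "\<And>u. br u (\<phi>' (e (2 * n - 1)) (y 1)) = scale (b 1) (R u)"
    by (rule odd_decomposition[OF n]) (rule that)
  \<comment> \<open>Bracketing \<open>y 1\<close> with the remaining value gives \<open>b 1\<close>
    times \<open>[y 1, y 1] = x 1\<close>, and \<open>cocycle_last_value\<close> says it is
    zero.\<close>
  have "scale (b 1) (x 1) = 0"
    using cocycle_last_value[OF n \<phi>' \<phi>'_e, of "y 1"] b(2)[of "y 1"] n by (simp add: R_def br_y_y)
  moreover have "x 1 \<noteq> 0"
    using independent_basis dependent_zero[of basis_vectors] x_in[of 1] n by (metis atLeastAtMost_iff le_refl)
  ultimately have b1: "b 1 = 0" by simp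
  have v: "\<phi>' (e (2 * n - 1)) (y 1) = (\<Sum>k\<in>{2..n}. scale (b k) (y k))"
  proof -
    have "{1..n} = insert 1 {2..n}" using n by auto
    then show ?thesis unfolding b(1) by (simp add: b1)
  qed
  \<comment> \<open>Compensates the factor \<open>(1/2) ^ (n - 1)\<close> of
    \<open>psi_e_y1\<close>.\<close>
  define c where "c k = 2 ^ (n - 1) * b k" for k
  define \<rho> where "\<rho> u v = \<phi>' u v - (\<Sum>k\<in>{2..n}. scale (c k) (psi k u v))" for u v
  have \<rho>: "is_even_cocycle2 scale grading br \<rho>"
    unfolding \<rho>_def
    by (intro cocycle2_diff cocycle2_sum cocycle2_scale psi_cocycle2 \<phi>')
  have 1: "2 ^ m * (1/2) ^ m = (1::'a)" for m
    by (simp flip: power_mult_distrib)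
  have c: "c k * (1/2) ^ (n - 1) = b k" for k
    using 1[of "n - 1"] by (simp add: c_def mult_ac)
  have "\<rho> (e m) (y 1) = 0" if m: "m < 2 * n" for m
  proof -
    have "(\<Sum>k\<in>{2..n}. scale (c k) (psi k (e m) (y 1)))
        = (if m = 2 * n - 1 then \<Sum>k\<in>{2..n}. scale (b k) (y k) else 0)"
      using m c by (simp add: psi_e_y1)
    then show ?thesis
      using m v \<phi>'_e[of m] by (cases "m = 2 * n - 1") (simp_all add: \<rho>_def)
  qed
  from cocycle_eq_0[OF n \<rho> this]
  have "\<phi> = (\<lambda>u v. d1 br f u v + (\<Sum>k\<in>{2..n}. scale (c k) (psi k u v)))"
    by (simp add: fun_eq_iff \<rho>_def \<phi>'_def algebra_simps)
  with f(1) show thesis by (rule that)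
qed

section \<open>Independence modulo coboundaries\<close>

lemma coboundary_last_value:
  assumes n: "n \<ge> 1" and f: "even_linear scale grading f"
    and e: "\<And>m. m < 2 * n - 1 \<Longrightarrow> d1 br f (e m) (y 1) = 0"
  shows "d1 br f (e (2 * n - 1)) (y 1) = 0"
proof -
  interpret f: Vector_Spaces.linear scale scale f using f by (simp add: even_linear_def)
  have "f (y 1) \<in> grading 1"
    using f grading_y1[OF n] by (simp add: even_linear_def)
  then obtain b where b: "\<And>u. br u (f (y 1)) = scale b (R u)"
    using odd_decomposition[OF n] by metis
  have d1: "d1 br f (e m) (y 1) = scale b (e (Suc m)) + R (f (e m)) - f (e (Suc m))" for m
    by (simp add: d1_def b e_Suc R_def)
  \<comment> \<open>Vanishing of \<open>d1 br f\<close> gives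
    \<open>f (e (Suc m)) = R (f (e m)) + scale b (e (Suc m))\<close>; each step applies
    \<open>R\<close> and adds one more copy of \<open>b\<close>.\<close>
  have fe: "f (e m) = (R ^^ m) (f (y 1)) + scale (of_nat m * b) (e m)" if "m < 2 * n" for m
    using that
  proof (induction m)
    case (Suc m)
    then have "f (e (Suc m)) = scale b (e (Suc m)) + R (f (e m))"
      using e[of m] d1[of m] by simp
    then show ?case
      using Suc by (simp add: R_lin e_Suc distrib_right scale_left_distrib)
  qed (simp add: e_0)
  have "Vector_Spaces.linear scale scale (R ^^ (2 * n))"
    by (rule linear_overI) (simp_all add: R_funpow_lin)
  \<comment> \<open>\<open>R\<close> shifts the chain, so its \<open>2 * n\<close>-th power sends
    \<open>e m\<close> to \<open>e (2 * n + m) = 0\<close>.\<close>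
  then have nil: "(R ^^ (2 * n)) u = 0" for u
  proof (rule linear_zero_on_e)
    show "(R ^^ (2 * n)) (e m) = 0" for m
      using e_eq_0[of "2 * n + m"] n by (simp add: e_def funpow_add)
  qed
  have S: "Suc (2 * n - 1) = 2 * n" using n by simp
  have "R (f (e (2 * n - 1))) = (R ^^ Suc (2 * n - 1)) (f (y 1))
      + scale (of_nat (2 * n - 1) * b) (e (Suc (2 * n - 1)))"
    using n by (subst fe) (simp_all only: R_lin e_Suc funpow.simps o_apply)
  also have "\<dots> = 0" unfolding S nil using e_eq_0[of "2 * n"] n by simp
  finally show ?thesis
    using e_eq_0[of "2 * n"] n unfolding d1 S by simp
qed

lemma psi_independent_mod_coboundaries:
  assumes n: "n \<ge> 1" and f: "even_linear scale grading f"
    and eq: "(\<lambda>u v. \<Sum>k\<in>{2..n}. scale (c k) (psi k u v)) = d1 br f"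
  shows "\<forall>k\<in>{2..n}. c k = 0"
proof -
  have d1: "d1 br f (e m) (y 1) = (if m = 2 * n - 1
      then \<Sum>k\<in>{2..n}. scale (c k) (scale ((1/2) ^ (n - 1)) (y k)) else 0)" if "m < 2 * n" for m
    unfolding eq[symmetric] using that by (simp add: psi_e_y1)
  have "d1 br f (e (2 * n - 1)) (y 1) = 0"
    by (rule coboundary_last_value[OF n f]) (simp add: d1)
  then have "scale ((1/2) ^ (n - 1)) (\<Sum>k\<in>{2..n}. scale (c k) (y k)) = 0"
    using n d1[of "2 * n - 1"] by (simp add: scale_sum_right mult_ac)
  then have "(\<Sum>k\<in>{2..n}. scale (c k) (y k)) = 0" by simp
  \<comment> \<open>Independence in the library concerns sums over sets of vectors, so the indices
    are replaced by the vectors \<open>y k\<close>.\<close>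
  moreover have "(\<Sum>k\<in>{2..n}. scale (c k) (y k))
      = (\<Sum>w\<in>y ` {2..n}. scale (c (the_inv_into {1..n} y w)) w)"
  proof -
    have "inj_on y {2..n}" using inj_y by (rule inj_on_subset) auto
    then show ?thesis
      by (simp add: sum.reindex the_inv_into_f_f[OF inj_y])
  qed
  ultimately have "c (the_inv_into {1..n} y (y k)) = 0" if "k \<in> {2..n}" for k
    using that by (intro independentD[OF independent_basis, where t = "y ` {2..n}"]) auto
  then show ?thesis by (simp add: the_inv_into_f_f[OF inj_y])
qed

end

theorem corollary4p6:
  fixes scale :: "'a::field_char_0 \<Rightarrow> 'v::ab_group_add \<Rightarrow> 'v"
    and n :: nat
    and x y :: "nat \<Rightarrow> 'v"
    and NF :: "'v \<Rightarrow> 'v \<Rightarrow> 'v"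
  assumes "n \<ge> 1"
    and "null_filiform scale n x y NF"
  shows "let V = nf_basis.grading scale n x y;
             cls = (\<lambda>k. cohomology_class scale V NF (nf_basis.psi scale n x y k))
         in inj_on cls {2..n} \<and>
            vectorspace.basis class_ring (HL2_even scale V NF) (cls ` {2..n})"
proof -
  interpret null_filiform scale n x y NF by (rule assms(2))
  interpret Z: vectorspace class_ring "ZL2_even scale grading NF"
    by (rule vectorspace_ZL2_even)
  \<comment> \<open>For \<open>n = 1\<close> the index set is empty, and the result says that the
    cohomology is zero.\<close>
  have psi: "psi \<in> {2..n} \<rightarrow> carrier (ZL2_even scale grading NF)"
    using psi_cocycle2 by (auto simp: ZL2_even_def)
  note finsum = finsum_ZL2_even[OF finite_atLeastAtMost psi]
  have indep: "\<forall>k\<in>{2..n}. c k = \<zero>\<^bsub>class_ring\<^esub>"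
    if "(\<Oplus>\<^bsub>ZL2_even scale grading NF\<^esub>k\<in>{2..n}. c k \<odot>\<^bsub>ZL2_even scale grading NF\<^esub> psi k)
      \<in> BL2_even scale grading NF" for c
    using that psi_independent_mod_coboundaries[OF assms(1)]
    unfolding finsum BL2_even_def by auto
  have gen: "\<exists>c\<in>{2..n} \<rightarrow> carrier class_ring. \<exists>h\<in>BL2_even scale grading NF.
      \<phi> = h \<oplus>\<^bsub>ZL2_even scale grading NF\<^esub>
        (\<Oplus>\<^bsub>ZL2_even scale grading NF\<^esub>k\<in>{2..n}. c k \<odot>\<^bsub>ZL2_even scale grading NF\<^esub> psi k)"
    if "\<phi> \<in> carrier (ZL2_even scale grading NF)" for \<phi>
  proof -
    have "is_even_cocycle2 scale grading NF \<phi>"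
      using that by (simp add: ZL2_even_def)
    then obtain f c where "even_linear scale grading f"
      "\<phi> = (\<lambda>u v. d1 NF f u v + (\<Sum>k\<in>{2..n}. scale (c k) (psi k u v)))"
      using cocycle_decomposition[OF assms(1)] by blast
    then have "d1 NF f \<in> BL2_even scale grading NF"
      "\<phi> = d1 NF f \<oplus>\<^bsub>ZL2_even scale grading NF\<^esub>
        (\<Oplus>\<^bsub>ZL2_even scale grading NF\<^esub>k\<in>{2..n}. c k \<odot>\<^bsub>ZL2_even scale grading NF\<^esub> psi k)"
      unfolding finsum by (auto simp: BL2_even_def ZL2_even_def)
    then show ?thesis by (intro bexI[of _ c] bexI[of _ "d1 NF f"]) auto
  qed
  show ?thesis
    unfolding Let_def cohomology_class_def HL2_even_def
    using Z.quotient_module_basisI[OF subspace_BL2_even finite_atLeastAtMost psi indep gen] by blast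
qed

end
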